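(* Let $0<a<1$ and $0\le b<1$. The probability measure $\mu$ associated with $f_\pm$ (defined in the context) is the only probability measure on $[0,1]$ that is invariant under $f_-$ or $f_+$. That is, a Borel probability measure $\nu$ on $[0,1]$ is invariant under at least one of $f_-$ and $f_+$ if and only if $\nu=\mu$.
   Context: For real $x$ let $\{x\}:=x-\lfloor x\rfloor\in[0,1)$ and $\{x\}_+:=1-\{-x\}\in(0,1]$. For constants $0<a<1$, $0\le b<1$ define $f_-,f_+:[0,1]\to[0,1]$ by $f_-(x)=\{ax+b\}$, $f_+(x)=\{ax+b\}_+$, and let $f_\pm$ be the multi-valued map $x\mapsto\{f_-(x),f_+(x)\}$. An orbit of $f_\pm$ is any sequence $(x_n)_{n\ge0}$ in $[0,1]$ with $x_{n+1}\in f_\pm(x_n)$ for all $n\ge0$; it is periodic if $x_{n+q}=x_n$ for some $q\ge1$ and all $n\ge0$. Rotation number: let $F_-(x):=ax+b+(1-a)\lfloor x\rfloor$ and $F_+(x):=ax+b-(1-a)\lfloor 1-x\rfloor$ for $x\in\mathbb R$. The rotation number $\rho\in[0,1)$ of $f_\pm$ is the number such that $F_-^n(x)/n\to\rho$ and $F_+^n(x)/n\to\rho$ as $n\to\infty$ for every $x\in\mathbb R$ (the limits exist, coincide and do not depend on $x$). The measure $\mu$: if $\rho$ is rational, then $f_\pm$ has a periodic orbit, whose set of points $C$ is unique, and $\mu$ is the uniform probability measure on the finite set $C$ (mass $1/|C|$ at each point). If $\rho$ is irrational, $\mu$ is the image of Lebesgue measure on $[0,1]$ under the map $$\phi_\rho(x):=\frac{b}{1-a}+(1-a)\sum_{j=0}^\infty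 a^j\lfloor x-(j+1)\rho\rfloor ,$$ which maps $[0,1]$ into $[0,1]$ in this case. *)

theory Defs
  imports "HOL-Probability.Probability"
begin

definition frac_pos :: "real \<Rightarrow> real" where
  "frac_pos x = 1 - frac (- x)"

definition f_minus :: "real \<Rightarrow> real \<Rightarrow> real \<Rightarrow> real" where
  "f_minus a b x = frac (a * x + b)"

definition f_plus :: "real \<Rightarrow> real \<Rightarrow> real \<Rightarrow> real" where
  "f_plus a b x = frac_pos (a * x + b)"

definition f_pm :: "real \<Rightarrow> real \<Rightarrow> real \<Rightarrow> real set" where
  "f_pm a b x = {f_minus a b x, f_plus a b x}"

definition is_orbit :: "real \<Rightarrow> real \<Rightarrow> (nat \<Rightarrow> real) \<Rightarrow> bool" where
  "is_orbit a b x \<longleftrightarrow> (\<forall>n. x n \<in> {0..1}) \<and> (\<forall>n. x (Suc n) \<in> f_pm a b (x n))"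

definition is_periodic_orbit :: "real \<Rightarrow> real \<Rightarrow> (nat \<Rightarrow> real) \<Rightarrow> bool" where
  "is_periodic_orbit a b x \<longleftrightarrow> is_orbit a b x \<and> (\<exists>q\<ge>1. \<forall>n. x (n + q) = x n)"

definition F_minus :: "real \<Rightarrow> real \<Rightarrow> real \<Rightarrow> real" where
  "F_minus a b x = a * x + b + (1 - a) * of_int \<lfloor>x\<rfloor>"

definition F_plus :: "real \<Rightarrow> real \<Rightarrow> real \<Rightarrow> real" where
  "F_plus a b x = a * x + b - (1 - a) * of_int \<lfloor>1 - x\<rfloor>"

definition is_rotation_number :: "real \<Rightarrow> real \<Rightarrow> real \<Rightarrow> bool" where
  "is_rotation_number a b \<rho> \<longleftrightarrow> 0 \<le> \<rho> \<and> \<rho> < 1 \<and>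
     (\<forall>x. (\<lambda>n. (F_minus a b ^^ n) x / real n) \<longlonglongrightarrow> \<rho> \<and>
          (\<lambda>n. (F_plus a b ^^ n) x / real n) \<longlonglongrightarrow> \<rho>)"

definition rotation_number :: "real \<Rightarrow> real \<Rightarrow> real" where
  "rotation_number a b = (THE \<rho>. is_rotation_number a b \<rho>)"

definition periodic_set :: "real \<Rightarrow> real \<Rightarrow> real set" where
  "periodic_set a b = (THE C. \<exists>x. is_periodic_orbit a b x \<and> C = range x)"

definition phi :: "real \<Rightarrow> real \<Rightarrow> real \<Rightarrow> real \<Rightarrow> real" where
  "phi a b \<rho> x = b / (1 - a) + (1 - a) * (\<Sum>j. a ^ j * of_int \<lfloor>x - (real j + 1) * \<rho>\<rfloor>)"

definition unit_borel :: "real measure" where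
  "unit_borel = restrict_space borel {0..1}"

text \<open>The uniform measure on the finite set \<^term>\<open>periodic_set a b\<close> lives on that set, with all
  subsets measurable; pushing it forward along the inclusion makes it a Borel measure on the unit
  interval.\<close>

definition mu :: "real \<Rightarrow> real \<Rightarrow> real measure" where
  "mu a b =
     (if rotation_number a b \<in> \<rat>
      then distr (uniform_count_measure (periodic_set a b)) unit_borel (\<lambda>x. x)
      else distr (restrict_space lborel {0..1}) unit_borel (phi a b (rotation_number a b)))"

definition borel_prob_on_unit :: "real measure \<Rightarrow> bool" where
  "borel_prob_on_unit \<nu> \<longleftrightarrow> sets \<nu> = sets unit_borel \<and> prob_space \<nu>"

definition invariant_under :: "(real \<Rightarrow> real) \<Rightarrow> real measure \<Rightarrow> bool" where
  "invariant_under f \<nu> \<longleftrightarrow> f \<in> measurable \<nu> \<nu> \<and>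
     (\<forall>A\<in>sets \<nu>. emeasure \<nu> (f -` A \<inter> space \<nu>) = emeasure \<nu> A)"

text \<open>The measurability clause in \<^const>\<open>invariant_under\<close> is automatic for the two maps.\<close>

lemma f_minus_measurable: "f_minus a b \<in> measurable unit_borel unit_borel"
proof -
  have "f_minus a b \<in> borel_measurable borel"
    unfolding f_minus_def frac_def by measurable
  moreover have "f_minus a b x \<in> {0..1}" for x
    using frac_lt_1[of "a * x + b"] by (simp add: f_minus_def)
  ultimately show ?thesis
    unfolding unit_borel_def by (intro measurable_restrict_space3) auto
qed

lemma f_plus_measurable: "f_plus a b \<in> measurable unit_borel unit_borel"
proof -
  have "f_plus a b \<in> borel_measurable borel"
    unfolding f_plus_def frac_pos_def frac_def by measurable
  moreover have "f_plus a b x \<in> {0..1}" for x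
    using frac_lt_1[of "- (a * x + b)"] frac_ge_0[of "- (a * x + b)"]
    by (simp add: f_plus_def frac_pos_def del: minus_add_distrib)
  ultimately show ?thesis
    unfolding unit_borel_def by (intro measurable_restrict_space3) auto
qed

end

(* The lift of an f_-invariant measure has a distribution function G with G(F_- x) = G x + s, so its
   right-continuous quantile function Q satisfies Q(u + s) = F_-(Q u) = a Q u + b + (1 - a) floor u.
   This equation contracts, and its only solution at bounded distance from the identity is phi_s;
   iterating it shows that s is the rotation number. The reflection x -> 1 - x turns f_+ into an f_-
   (with 1 - a - b in place of b and -s in place of s), so that the quantile function of an
   f_+-invariant measure is the left-continuous version of phi_s. Hence any two measures that are
   invariant under f_- or f_+ coincide.

   The rotation number r is found as the largest r with phi_r(0) >= 0. Then phi_r, or its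
   left-continuous version, semiconjugates the rotation by r to f_- or to f_+, which gives a periodic
   orbit when r is rational and the invariance of mu when r is irrational. A periodic orbit of the
   multi-valued map that used both values at the discontinuity would yield a periodic orbit of f_-
   and one of f_+ with different point sets, contradicting uniqueness of the invariant measure. *)
theory Submission
  imports Defs "HOL-Analysis.Kronecker_Approximation_Theorem"
begin

subsection \<open>The series phi\<close>

text \<open>Some multiple of \<open>r\<close> lies at an integer or just below one: the denominator
  does this for rational \<open>r\<close>, Kronecker's theorem for irrational \<open>r\<close>. This
  produces the jump of \<open>phi\<close> shortly before 1 in
  \<open>phi_strict_at_1\<close>.\<close>

lemma recurrence_frac:
  fixes r \<epsilon> :: real
  assumes "0 < \<epsilon>"
  obtains n :: nat where "0 < n" "frac (- (real n * r)) < \<epsilon>"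
proof (cases "r \<in> \<rat>")
  case True
  then obtain p q :: int where r: "r = of_int p / of_int q" and q: "0 < q"
    by (meson Rats_cases')
  have "real (nat q) * r = of_int p"
    using q by (simp add: r)
  then have "- (real (nat q) * r) = of_int (- p)" by simp
  then have "frac (- (real (nat q) * r)) = 0" by (metis frac_of_int)
  with q assms show ?thesis
    by (intro that[of "nat q"]) linarith+
next
  case False
  then have "- r \<notin> \<rat>" by simp
  from Kronecker_approx_1_explicit[OF this, of 0 \<epsilon>] assms
  obtain k where "0 < k" "\<bar>frac (real k * - r) - 0\<bar> < \<epsilon>" by auto
  then show ?thesis by (intro that[of k]) auto
qed

locale contraction =
  fixes a :: real
  assumes a_pos: "0 < a" and a_less_1: "a < 1"
begin

section \<open>Convergence, monotonicity and functional equations of the series\<close>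

lemma summable_phi_majorant: "summable (\<lambda>j. C * (real (Suc j) * a ^ j))"
  using geometric_deriv_sums[of a] a_pos a_less_1
  by (intro summable_mult) (auto simp: sums_iff)

text \<open>The explicit dependence on \<open>r\<close> gives one majorant for all bounded
  \<open>r\<close>, as Tannery's theorem needs in
  \<open>phi_rotation_left_continuous\<close>.\<close>

lemma phi_term_bound:
  "norm (a ^ j * of_int \<lfloor>x - (real j + 1) * r\<rfloor>) \<le> (\<bar>x\<bar> + \<bar>r\<bar> + 1) * (real (Suc j) * a ^ j)"
proof -
  have "\<bar>of_int \<lfloor>x - (real j + 1) * r\<rfloor>\<bar> \<le> \<bar>x - (real j + 1) * r\<bar> + (1::real)"
    by linarith
  also have "\<bar>x - (real j + 1) * r\<bar> \<le> \<bar>x\<bar> + (real j + 1) * \<bar>r\<bar>"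
    using abs_triangle_ineq4[of x "(real j + 1) * r"] by (simp add: abs_mult)
  also have "\<bar>x\<bar> + (real j + 1) * \<bar>r\<bar> + 1 \<le> (\<bar>x\<bar> + \<bar>r\<bar> + 1) * real (Suc j)"
    by (simp add: algebra_simps)
  finally have "\<bar>of_int \<lfloor>x - (real j + 1) * r\<rfloor>\<bar> \<le> (\<bar>x\<bar> + \<bar>r\<bar> + 1) * real (Suc j)"
    by simp
  from mult_left_mono[OF this, of "a ^ j"] a_pos show ?thesis
    by (simp add: abs_mult mult_ac)
qed

lemma summable_phi: "summable (\<lambda>j. a ^ j * of_int \<lfloor>x - (real j + 1) * r\<rfloor>)"
  by (rule summable_comparison_test'[OF summable_phi_majorant phi_term_bound])

text \<open>With equal \<open>b\<close> the constant term cancels, so comparisons of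
  \<open>phi\<close> reduce to comparisons of floors, term by term.\<close>

lemma phi_diff_sums:
  "(\<lambda>j. (1 - a) * (a ^ j * (of_int \<lfloor>y - (real j + 1) * s\<rfloor> - of_int \<lfloor>x - (real j + 1) * r\<rfloor>)))
     sums (phi a b s y - phi a b r x)"
  unfolding phi_def
  using sums_mult[OF sums_diff[OF summable_sums summable_sums, OF summable_phi[of y s] summable_phi[of x r]], of "1 - a"]
  by (simp add: algebra_simps)

lemma phi_le_phi:
  assumes "\<And>j. \<lfloor>x - (real j + 1) * r\<rfloor> \<le> \<lfloor>y - (real j + 1) * s\<rfloor>"
  shows "phi a b r x \<le> phi a b s y"
proof -
  have "0 \<le> phi a b s y - phi a b r x"
    by (rule sums_le[OF _ sums_zero phi_diff_sums]) (use assms a_pos a_less_1 in auto)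
  then show ?thesis by simp
qed

lemma phi_mono: "x \<le> y \<Longrightarrow> phi a b r x \<le> phi a b r y"
  by (intro phi_le_phi floor_mono) simp

lemma phi_antimono_rotation: "r \<le> s \<Longrightarrow> phi a b s x \<le> phi a b r x"
  by (intro phi_le_phi floor_mono diff_left_mono mult_left_mono) auto

lemma phi_add_1: "phi a b r (x + 1) = phi a b r x + 1"
proof -
  have "(\<lambda>j. (1 - a) * a ^ j) sums (phi a b r (x + 1) - phi a b r x)"
    using phi_diff_sums[of "x + 1" r x r b] by (simp add: algebra_simps flip: add_diff_eq)
  moreover have "(\<lambda>j. (1 - a) * a ^ j) sums ((1 - a) * (1 / (1 - a)))"
    using a_pos a_less_1 by (intro sums_mult geometric_sums) auto
  ultimately show ?thesis
    using a_less_1 sums_unique2 by fastforce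
qed

lemma phi_add_of_int: "phi a b r (x + of_int k) = phi a b r x + of_int k"
proof (induction k rule: int_induct[of _ 0])
  case (step1 i)
  then show ?case using phi_add_1[of b r "x + of_int i"] by (simp add: add.assoc)
next
  case (step2 i)
  then show ?case using phi_add_1[of b r "x + of_int (i - 1)"] by simp
qed simp

text \<open>Index shift: term \<open>Suc j\<close> at \<open>x + r\<close> is \<open>a\<close> times
  term \<open>j\<close> at \<open>x\<close>, and the head term is the floor of
  \<open>x\<close>.\<close>

lemma phi_add_rotation: "phi a b r (x + r) = a * phi a b r x + b + (1 - a) * of_int \<lfloor>x\<rfloor>"
proof -
  let ?t = "\<lambda>x j. a ^ j * of_int \<lfloor>x - (real j + 1) * r\<rfloor>"
  have "suminf (?t (x + r)) = (\<Sum>j. ?t (x + r) (Suc j)) + ?t (x + r) 0"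
    using suminf_split_head[OF summable_phi[of "x + r" r]] by simp
  also have "(\<Sum>j. ?t (x + r) (Suc j)) = (\<Sum>j. a * ?t x j)"
    by (intro suminf_cong) (simp add: algebra_simps)
  also have "\<dots> = a * suminf (?t x)"
    by (rule suminf_mult[OF summable_phi])
  finally have *: "suminf (?t (x + r)) = a * suminf (?t x) + of_int \<lfloor>x\<rfloor>" by simp
  have "phi a b r (x + r) = b / (1 - a) + (1 - a) * (a * suminf (?t x) + of_int \<lfloor>x\<rfloor>)"
    unfolding phi_def * ..
  \<comment> \<open>The constant term is the fixed point of \<open>y\<close> to
    \<open>a * y + b\<close>, so it obeys the same recursion.\<close>
  also have "b / (1 - a) = a * (b / (1 - a)) + b"
    using a_less_1 by (simp add: field_simps)
  finally show ?thesis
    unfolding phi_def by (simp add: algebra_simps)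
qed

text \<open>Replacing \<open>b\<close> by \<open>1 - a - b\<close> and \<open>r\<close> by \<open>- r\<close> corresponds to conjugating with the reflection
  \<open>x \<mapsto> - x\<close>; the reflected \<^const>\<open>phi\<close> is the left-continuous version of \<^const>\<open>phi\<close>.\<close>

lemma phi_reflect_sums:
  "(\<lambda>j. (1 - a) * (a ^ j * (of_int \<lfloor>y - (real j + 1) * s\<rfloor> + of_int \<lfloor>- x + (real j + 1) * r\<rfloor> + 1)))
     sums (phi a b s y + phi a (1 - a - b) (- r) (- x))"
proof -
  \<comment> \<open>The \<open>+ 1\<close> in each summand reflects floor(-z) = -floor(z) - 1 for
    non-integer z. Weighted by \<open>1 - a\<close>, these ones add up to 1, which is also the sum
    of the two constant terms.\<close>
  have "(\<lambda>j. a ^ j) sums (1 / (1 - a))"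
    using a_pos a_less_1 by (intro geometric_sums) auto
  from sums_mult[OF sums_add[OF this sums_add[OF summable_sums summable_sums, OF summable_phi[of y s] summable_phi[of "- x" "- r"]]], of "1 - a"]
  have "(\<lambda>j. (1 - a) * (a ^ j * (of_int \<lfloor>y - (real j + 1) * s\<rfloor> + of_int \<lfloor>- x + (real j + 1) * r\<rfloor> + 1)))
     sums ((1 - a) * (1 / (1 - a) + (suminf (\<lambda>j. a ^ j * of_int \<lfloor>y - (real j + 1) * s\<rfloor>) + 
         suminf (\<lambda>j. a ^ j * of_int \<lfloor>- x - (real j + 1) * (- r)\<rfloor>))))"
    by (simp add: algebra_simps)
  also have "\<dots> = 1 + (1 - a) * (suminf (\<lambda>j. a ^ j * of_int \<lfloor>y - (real j + 1) * s\<rfloor>) + 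
         suminf (\<lambda>j. a ^ j * of_int \<lfloor>- x - (real j + 1) * (- r)\<rfloor>))"
    using a_less_1 by (simp add: ring_distribs)
  also have "\<dots> = phi a b s y + phi a (1 - a - b) (- r) (- x)"
  proof -
    have "b / (1 - a) + (1 - a - b) / (1 - a) = 1"
      using a_less_1 by (simp flip: add_divide_distrib)
    then show ?thesis
      unfolding phi_def distrib_left by linarith
  qed
  finally show ?thesis .
qed

text \<open>The floors of z and -z add up to -1 or 0, so no summand of
  \<open>phi_reflect_sums\<close> is negative.\<close>

lemma phi_reflect_le: "- phi a (1 - a - b) (- r) (- x) \<le> phi a b r x"
proof -
  have "0 \<le> \<lfloor>x - (real j + 1) * r\<rfloor> + \<lfloor>- x + (real j + 1) * r\<rfloor> + 1" for j
    by linarith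
  then have "0 \<le> real_of_int \<lfloor>x - (real j + 1) * r\<rfloor> + of_int \<lfloor>- x + (real j + 1) * r\<rfloor> + 1" for j
    by (metis (mono_tags, lifting) of_int_0_le_iff of_int_1 of_int_add)
  then have "0 \<le> phi a b r x + phi a (1 - a - b) (- r) (- x)"
    using a_pos a_less_1
    by (intro sums_le[OF _ sums_zero phi_reflect_sums[of x r x r b]] mult_nonneg_nonneg) auto
  then show ?thesis by simp
qed

text \<open>Floor is superadditive and floor(x - y) is at most -1, so no summand is positive. With
  \<open>phi_reflect_le\<close> this interlaces the two versions of \<open>phi\<close>, which is
  what the uniqueness proof uses.\<close>

lemma phi_le_reflect:
  assumes "x < y"
  shows "phi a b r x \<le> - phi a (1 - a - b) (- r) (- y)"
proof -
  have "\<lfloor>x - (real j + 1) * r\<rfloor> + \<lfloor>- y + (real j + 1) * r\<rfloor> + 1 \<le> 0" for j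
    using assms by linarith
  then have "real_of_int \<lfloor>x - (real j + 1) * r\<rfloor> + of_int \<lfloor>- y + (real j + 1) * r\<rfloor> + 1 \<le> 0" for j
    by (metis (mono_tags, lifting) of_int_le_0_iff of_int_1 of_int_add)
  then have "phi a b r x + phi a (1 - a - b) (- r) (- y) \<le> 0"
    using a_pos a_less_1
    by (intro sums_le[OF _ phi_reflect_sums[of x r y r b] sums_zero] mult_nonneg_nonpos) auto
  then show ?thesis by simp
qed

text \<open>For irrational \<open>r\<close> no multiple \<open>(j + 1) * r\<close> is an integer, so
  0 is not a jump and both versions agree there.\<close>

lemma phi_reflect_eq_0:
  assumes "r \<notin> \<rat>"
  shows "phi a (1 - a - b) (- r) 0 = - phi a b r 0"
proof -
  have "\<lfloor>- ((real j + 1) * r)\<rfloor> + \<lfloor>(real j + 1) * r\<rfloor> + 1 = 0" for j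
  proof -
    have "(real j + 1) * r \<notin> \<int>"
    proof
      assume "(real j + 1) * r \<in> \<int>"
      then have "(real j + 1) * r / (real j + 1) \<in> \<rat>"
        by (intro Rats_divide) (auto intro: Ints_subset_Rats[THEN subsetD])
      with assms show False by (simp del: of_nat_Suc add: add_eq_0_iff)
    qed
    then show ?thesis
      by (simp add: floor_minus ceiling_altdef) (metis Ints_of_int)
  qed
  then have "real_of_int \<lfloor>0 - (real j + 1) * r\<rfloor> + of_int \<lfloor>- 0 + (real j + 1) * r\<rfloor> + 1 = 0" for j
    by simp (metis (mono_tags, lifting) of_int_0 of_int_1 of_int_add)
  then have "(\<lambda>j. 0) sums (phi a b r 0 + phi a (1 - a - b) (- r) 0)"
    using phi_reflect_sums[of 0 r 0 r b] by simp
  then show ?thesis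
    using sums_unique2[OF sums_zero] by fastforce
qed

text \<open>The jumps of \<open>phi\<close> are the points congruent to some
  \<open>(j + 1) * r\<close> modulo 1; recurrence places one in the interval from \<open>x\<close>
  (excluded) to 1 (included).\<close>

lemma phi_strict_at_1:
  assumes "x < 1"
  shows "phi a b r x < phi a b r 1"
proof -
  obtain n where n: "0 < n" "frac (- (real n * r)) < 1 - x"
    using recurrence_frac[of "1 - x" r] assms by auto
  define j where "j = n - 1"
  have j: "frac (- ((real j + 1) * r)) < 1 - x"
    using n by (simp add: j_def of_nat_diff)
  let ?f = "\<lambda>j. (1 - a) * (a ^ j * (of_int \<lfloor>1 - (real j + 1) * r\<rfloor> - of_int \<lfloor>x - (real j + 1) * r\<rfloor>))"
  have nonneg: "0 \<le> ?f i" for i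
    using assms a_pos a_less_1 by (auto intro!: mult_nonneg_nonneg floor_mono)
  have "\<lfloor>x - y\<rfloor> < \<lfloor>1 - y\<rfloor>" if "frac (- y) < 1 - x" for y
  proof -
    have "\<lfloor>1 - y\<rfloor> = \<lfloor>- y\<rfloor> + 1" by linarith
    with that show ?thesis
      unfolding frac_def floor_less_iff by simp
  qed
  from this[OF j] have "\<lfloor>x - (real j + 1) * r\<rfloor> < \<lfloor>1 - (real j + 1) * r\<rfloor>" .
  then have "0 < ?f j"
    using a_pos a_less_1 by simp
  then have "0 < suminf ?f"
    using nonneg phi_diff_sums[of 1 r x r b] by (intro suminf_pos2) (auto simp: sums_iff)
  then show ?thesis
    using phi_diff_sums[of 1 r x r b] by (simp add: sums_iff)
qed

section \<open>Bounded solutions of the functional equation, and dependence on the rotation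
  parameter\<close>

lemma phi_sub_bound: "\<bar>phi a b r x - x\<bar> \<le> \<bar>phi a b r 0\<bar> + 1"
proof -
  have "phi a b r (of_int \<lfloor>x\<rfloor>) \<le> phi a b r x" "phi a b r x \<le> phi a b r (of_int \<lfloor>x\<rfloor> + 1)"
    by (intro phi_mono; linarith)+
  then show ?thesis
    using phi_add_of_int[of b r 0 "\<lfloor>x\<rfloor>"] phi_add_1[of b r "of_int \<lfloor>x\<rfloor>"] by simp linarith
qed

text \<open>The difference of two solutions satisfies D(u) = a^n D(u - n s) for every n, and it is
  bounded, so it vanishes.\<close>

lemma phi_unique:
  fixes Q :: "real \<Rightarrow> real"
  assumes eq: "\<And>u. Q (u + s) = a * Q u + b + (1 - a) * of_int \<lfloor>u\<rfloor>"
    and bound: "\<And>u. \<bar>Q u - u\<bar> \<le> B"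
  shows "Q u = phi a b s u"
proof -
  define D where "D u = Q u - phi a b s u" for u
  define B' where "B' = B + (\<bar>phi a b s 0\<bar> + 1)"
  have D_step: "D u = a * D (u - s)" for u
    using eq[of "u - s"] phi_add_rotation[of b s "u - s"] by (simp add: D_def algebra_simps)
  have D_iter: "D u = a ^ n * D (u - real n * s)" for n u
  proof (induction n)
    case (Suc n)
    then show ?case using D_step[of "u - real n * s"] by (simp add: algebra_simps)
  qed simp
  have "\<bar>D u\<bar> \<le> B'" for u
    using bound[of u] phi_sub_bound[of b s u] by (simp add: D_def B'_def)
  then have "\<bar>D u\<bar> \<le> a ^ n * B'" for n
    using a_pos by (subst D_iter[of u n]) (simp add: abs_mult)
  moreover have "(\<lambda>n. a ^ n * B') \<longlonglongrightarrow> 0 * B'"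
    using a_pos a_less_1 by (intro tendsto_mult LIMSEQ_realpow_zero tendsto_const) auto
  ultimately have "\<bar>D u\<bar> \<le> 0"
    by (intro LIMSEQ_le_const[of "\<lambda>n. a ^ n * B'"]) auto
  then show ?thesis by (simp add: D_def)
qed

text \<open>As \<open>t\<close> increases to \<open>r\<close>, \<open>- (j + 1) * t\<close>
  decreases to \<open>- (j + 1) * r\<close>, where floor is right-continuous; Tannery's theorem
  carries the limit through the sum. The inequality form suits the supremum argument in
  \<open>ex_phi_0_nonneg\<close>.\<close>

lemma phi_rotation_left_continuous:
  assumes "\<And>t. t < r \<Longrightarrow> c \<le> phi a b t 0"
  shows "c \<le> phi a b r 0"
proof -
  let ?f = "\<lambda>j t. a ^ j * of_int \<lfloor>0 - (real j + 1) * t\<rfloor>"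
  have lim: "(?f j \<longlongrightarrow> ?f j r) (at_left r)" for j
  proof -
    \<comment> \<open>The distance from \<open>- (j + 1) * r\<close> to the next larger integer,
      rescaled by \<open>j + 1\<close>: within it the floor does not change.\<close>
    define e where "e = (1 - frac (- ((real j + 1) * r))) / (real j + 1)"
    have e: "0 < e" using frac_lt_1[of "- ((real j + 1) * r)"] by (simp add: e_def)
    have "eventually (\<lambda>t. t \<in> {r - e<..<r}) (at_left r)"
      using e by (intro eventually_at_left_real) simp
    then have "eventually (\<lambda>t. ?f j t = ?f j r) (at_left r)"
    proof eventually_elim
      case (elim t)
      have lo: "(real j + 1) * t \<le> (real j + 1) * r"
        using elim by (intro mult_left_mono) auto
      have "(real j + 1) * (r - t) < (real j + 1) * e"
        using elim by (intro mult_strict_left_mono) auto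
      also have "\<dots> = 1 - frac (- ((real j + 1) * r))"
        by (simp add: e_def del: of_nat_Suc add: add_eq_0_iff)
      finally have "(real j + 1) * r - (real j + 1) * t < 1 - frac (- ((real j + 1) * r))"
        by (simp add: right_diff_distrib)
      with lo have "\<lfloor>- ((real j + 1) * t)\<rfloor> = \<lfloor>- ((real j + 1) * r)\<rfloor>"
        unfolding frac_def by (intro floor_unique) linarith+
      then show ?case by simp
    qed
    then show ?thesis by (rule tendsto_eventually)
  qed
  have "eventually (\<lambda>t. t \<in> {r - 1<..<r}) (at_left r)"
    by (intro eventually_at_left_real) simp
  then have ev: "eventually (\<lambda>t. \<forall>j. norm (?f j t) \<le> (\<bar>r\<bar> + 1 + 1) * (real (Suc j) * a ^ j)) (at_left r)"
  proof eventually_elim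
    case (elim t)
    show ?case
    proof
      fix j
      have "norm (?f j t) \<le> (\<bar>0\<bar> + \<bar>t\<bar> + 1) * (real (Suc j) * a ^ j)"
        by (rule phi_term_bound)
      also have "\<dots> \<le> (\<bar>r\<bar> + 1 + 1) * (real (Suc j) * a ^ j)"
        using elim a_pos by (intro mult_right_mono) auto
      finally show "norm (?f j t) \<le> (\<bar>r\<bar> + 1 + 1) * (real (Suc j) * a ^ j)" .
    qed
  qed
  have "eventually (\<lambda>(j, t). norm (?f j t) \<le> (\<bar>r\<bar> + 1 + 1) * (real (Suc j) * a ^ j)) (at_top \<times>\<^sub>F at_left r)"
    unfolding eventually_prod_filter
    by (rule exI[of _ "\<lambda>_. True"], rule exI, intro conjI, simp, rule ev) auto
  from tannerys_theorem[OF lim this summable_phi_majorant]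
  have "((\<lambda>t. \<Sum>j. ?f j t) \<longlongrightarrow> (\<Sum>j. ?f j r)) (at_left r)" by simp
  then have "((\<lambda>t. phi a b t 0) \<longlongrightarrow> phi a b r 0) (at_left r)"
    unfolding phi_def by (intro tendsto_intros)
  moreover have "eventually (\<lambda>t. c \<le> phi a b t 0) (at_left r)"
    using assms by (auto simp: eventually_at_left_field intro: exI[of _ "r - 1"])
  ultimately show ?thesis
    by (rule tendsto_lowerbound) simp
qed

end

subsection \<open>The rotation number\<close>

lemma mult_of_int_left_mono:
  fixes c :: real
  shows "0 \<le> c \<Longrightarrow> m \<le> n \<Longrightarrow> c * of_int m \<le> c * of_int n"
  by (intro mult_left_mono) auto

lemma tendsto_over_n_linear_bounds:
  fixes g :: "nat \<Rightarrow> real"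
  assumes "\<And>n. real n * r - C \<le> g n" and "\<And>n. g n \<le> real n * r + D"
  shows "(\<lambda>n. g n / real n) \<longlonglongrightarrow> r"
proof (rule real_tendsto_sandwich)
  have "(\<lambda>n. r - C / real n) \<longlonglongrightarrow> r - 0" "(\<lambda>n. r + D / real n) \<longlonglongrightarrow> r + 0"
    by (intro tendsto_intros lim_const_over_n)+
  then show "(\<lambda>n. r - C / real n) \<longlonglongrightarrow> r" "(\<lambda>n. r + D / real n) \<longlonglongrightarrow> r" by simp_all
  show "eventually (\<lambda>n. r - C / real n \<le> g n / real n) sequentially"
    using eventually_gt_at_top[of 0]
  proof eventually_elim
    case (elim n)
    have "(real n * r - C) / real n \<le> g n / real n"
      using assms(1) by (intro divide_right_mono) auto
    then show ?case using elim by (simp add: diff_divide_distrib)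
  qed
  show "eventually (\<lambda>n. g n / real n \<le> r + D / real n) sequentially"
    using eventually_gt_at_top[of 0]
  proof eventually_elim
    case (elim n)
    have "g n / real n \<le> (real n * r + D) / real n"
      using assms(2) by (intro divide_right_mono) auto
    then show ?case using elim by (simp add: add_divide_distrib)
  qed
qed

text \<open>Negation conjugates the two lifts, so lower bounds for \<open>F_minus\<close> yield
  upper bounds for \<open>F_plus\<close>.\<close>

lemma F_plus_reflect: "F_plus a b x = - F_minus a (1 - a - b) (- x)"
proof -
  have "\<lfloor>1 - x\<rfloor> = \<lfloor>- x\<rfloor> + 1" by linarith
  then show ?thesis by (simp add: F_plus_def F_minus_def algebra_simps)
qed

lemma F_plus_funpow_reflect: "(F_plus a b ^^ n) x = - (F_minus a (1 - a - b) ^^ n) (- x)"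
  by (induction n) (auto simp: F_plus_reflect)

context contraction
begin

lemma F_minus_mono: "x \<le> y \<Longrightarrow> F_minus a b x \<le> F_minus a b y"
  unfolding F_minus_def using a_pos a_less_1
  by (intro add_mono mult_left_mono) (auto intro: floor_mono)

lemma F_minus_funpow_mono: "x \<le> y \<Longrightarrow> (F_minus a b ^^ n) x \<le> (F_minus a b ^^ n) y"
  by (induction n) (auto intro: F_minus_mono)

lemma F_minus_less_F_plus:
  assumes "x < y"
  shows "F_minus a b x < F_plus a b y"
proof -
  have "\<lfloor>x\<rfloor> \<le> - \<lfloor>1 - y\<rfloor>" using assms by linarith
  then have "(1 - a) * of_int \<lfloor>x\<rfloor> \<le> (1 - a) * of_int (- \<lfloor>1 - y\<rfloor>)"
    using a_less_1 by (intro mult_of_int_left_mono) auto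
  moreover have "a * x < a * y" using assms a_pos by simp
  ultimately show ?thesis by (simp add: F_minus_def F_plus_def)
qed

lemma F_minus_funpow_less_F_plus: "x < y \<Longrightarrow> (F_minus a b ^^ n) x < (F_plus a b ^^ n) y"
  by (induction n) (auto intro: F_minus_less_F_plus)

lemma floor_le_phi:
  assumes "0 \<le> phi a b r 0"
  shows "of_int \<lfloor>x\<rfloor> \<le> phi a b r x"
proof -
  have "of_int \<lfloor>x\<rfloor> \<le> phi a b r (of_int \<lfloor>x\<rfloor>)"
    using phi_add_of_int[of b r 0 "\<lfloor>x\<rfloor>"] assms by simp
  also have "\<dots> \<le> phi a b r x" by (intro phi_mono) simp
  finally show ?thesis .
qed

text \<open>By \<open>phi_add_rotation\<close>, \<open>phi\<close> would semiconjugate the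
  translation to \<open>F_minus\<close> if floor x were the floor of phi(x). Here it is only at most
  that, so one inequality survives, and monotonicity iterates it.\<close>

lemma phi_le_F_minus_funpow:
  assumes "0 \<le> phi a b r 0"
  shows "phi a b r (y + real n * r) \<le> (F_minus a b ^^ n) (phi a b r y)"
proof (induction n)
  case (Suc n)
  let ?z = "y + real n * r"
  have "\<lfloor>?z\<rfloor> \<le> \<lfloor>phi a b r ?z\<rfloor>"
    using floor_le_phi[OF assms, of ?z] by linarith
  then have "(1 - a) * of_int \<lfloor>?z\<rfloor> \<le> (1 - a) * of_int \<lfloor>phi a b r ?z\<rfloor>"
    using a_less_1 by (intro mult_of_int_left_mono) auto
  then have "phi a b r (?z + r) \<le> F_minus a b (phi a b r ?z)"
    unfolding phi_add_rotation F_minus_def by simp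
  also have "\<dots> \<le> F_minus a b ((F_minus a b ^^ n) (phi a b r y))"
    using Suc by (rule F_minus_mono)
  finally show ?case by (simp add: algebra_simps)
qed simp

lemma F_minus_funpow_lower:
  assumes "0 \<le> phi a b r 0"
  obtains C where "\<And>n. real n * r - C \<le> (F_minus a b ^^ n) x"
proof -
  \<comment> \<open>An integer shift that puts \<open>phi a b r k\<close> below the starting
    point.\<close>
  define k where "k = \<lfloor>x - phi a b r 0\<rfloor>"
  have k: "phi a b r (of_int k) \<le> x"
    using phi_add_of_int[of b r 0 k] by (simp add: k_def) linarith
  have "real n * r - (1 - of_int k) \<le> (F_minus a b ^^ n) x" for n
  proof -
    have "real n * r - (1 - of_int k) \<le> of_int \<lfloor>of_int k + real n * r\<rfloor>" by linarith
    also have "\<dots> \<le> phi a b r (of_int k + real n * r)" by (rule floor_le_phi[OF assms])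
    also have "\<dots> \<le> (F_minus a b ^^ n) (phi a b r (of_int k))"
      by (rule phi_le_F_minus_funpow[OF assms])
    also have "\<dots> \<le> (F_minus a b ^^ n) x" by (rule F_minus_funpow_mono[OF k])
    finally show ?thesis .
  qed
  then show ?thesis by (rule that)
qed

text \<open>The first sign condition bounds \<open>F_minus\<close> from below, the second bounds
  \<open>F_plus\<close> from above by reflection. The two missing bounds follow because an
  \<open>F_minus\<close> orbit stays below the \<open>F_plus\<close> orbit started one unit
  higher.\<close>

lemma is_rotation_numberI:
  assumes r: "0 \<le> r" "r < 1"
    and nonneg: "0 \<le> phi a b r 0" "0 \<le> phi a (1 - a - b) (- r) 0"
  shows "is_rotation_number a b r"
proof -
  have lower: "\<exists>C. \<forall>n. real n * r - C \<le> (F_minus a b ^^ n) x" for x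
    using F_minus_funpow_lower[OF nonneg(1)] by metis
  have upper: "\<exists>C. \<forall>n. (F_plus a b ^^ n) x \<le> real n * r + C" for x
  proof -
    obtain C where C: "\<And>n. real n * - r - C \<le> (F_minus a (1 - a - b) ^^ n) (- x)"
      using F_minus_funpow_lower[OF nonneg(2)] by metis
    have "(F_plus a b ^^ n) x \<le> real n * r + C" for n
      using C[of n] by (simp add: F_plus_funpow_reflect)
    then show ?thesis by blast
  qed
  have "(\<lambda>n. (F_minus a b ^^ n) x / real n) \<longlonglongrightarrow> r" for x
  proof -
    obtain C where "\<And>n. real n * r - C \<le> (F_minus a b ^^ n) x" using lower by blast
    moreover obtain D where D: "\<And>n. (F_plus a b ^^ n) (x + 1) \<le> real n * r + D" using upper by blast
    have "(F_minus a b ^^ n) x \<le> real n * r + D" for n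
      using D[of n] F_minus_funpow_less_F_plus[of x "x + 1" n b] by simp
    ultimately show ?thesis by (rule tendsto_over_n_linear_bounds)
  qed
  moreover have "(\<lambda>n. (F_plus a b ^^ n) x / real n) \<longlonglongrightarrow> r" for x
  proof -
    obtain C where C: "\<And>n. real n * r - C \<le> (F_minus a b ^^ n) (x - 1)" using lower by blast
    have "real n * r - C \<le> (F_plus a b ^^ n) x" for n
      using C[of n] F_minus_funpow_less_F_plus[of "x - 1" x n b] by simp
    moreover obtain D where "\<And>n. (F_plus a b ^^ n) x \<le> real n * r + D" using upper by blast
    ultimately show ?thesis by (rule tendsto_over_n_linear_bounds)
  qed
  ultimately show ?thesis using r unfolding is_rotation_number_def by blast
qed

lemma rotation_number_eqI:
  assumes "is_rotation_number a b r"
  shows "rotation_number a b = r"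
  unfolding rotation_number_def
proof (rule the_equality)
  show "is_rotation_number a b r" by (fact assms)
next
  fix s assume "is_rotation_number a b s"
  with assms show "s = r"
    unfolding is_rotation_number_def by (meson LIMSEQ_unique)
qed

text \<open>The value of \<open>phi\<close> at 0 decreases in \<open>r\<close>, from b/(1 - a) at
  \<open>r = 0\<close> to (b - 1)/(1 - a) at \<open>r = 1\<close>. Left-continuity keeps it
  nonnegative at the supremum \<open>r\<close>; above \<open>r\<close> it is negative, so the
  reflected value is positive, and left-continuity in \<open>- r\<close> gives the second
  condition.\<close>

lemma ex_phi_0_nonneg:
  assumes b: "0 \<le> b" "b < 1"
  obtains r where "0 \<le> r" "r < 1" "0 \<le> phi a b r 0" "0 \<le> phi a (1 - a - b) (- r) 0"
proof -
  have phi_0: "0 \<le> phi a b 0 0"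
    using b a_less_1 by (simp add: phi_def)
  have "(1 - a) * phi a b 1 0 = b - 1"
    using phi_add_rotation[of b 1 0] phi_add_1[of b 1 0] by (simp add: algebra_simps)
  then have "(1 - a) * phi a b 1 0 < 0" using b by simp
  then have phi_1: "phi a b 1 0 < 0" using a_less_1 by (simp add: mult_less_0_iff)
  define S where "S = {r. 0 \<le> phi a b r 0}"
  define r where "r = Sup S"
  have "r' \<le> 1" if "r' \<in> S" for r'
    using that phi_1 phi_antimono_rotation[of 1 r' b 0] by (force simp: S_def)
  then have bdd: "bdd_above S" by (rule bdd_aboveI)
  have "0 \<in> S" using phi_0 by (simp add: S_def)
  then have "0 \<le> r" unfolding r_def using bdd by (rule cSup_upper)
  have "0 \<le> phi a b t 0" if "t < r" for t
  proof -
    obtain s where "s \<in> S" "t < s"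
      using \<open>t < r\<close> less_cSup_iff[of S t] bdd \<open>0 \<in> S\<close> unfolding r_def by auto
    then show ?thesis
      using phi_antimono_rotation[of t s b 0] by (simp add: S_def)
  qed
  then have left: "0 \<le> phi a b r 0" by (rule phi_rotation_left_continuous)
  have "r < 1"
    using left phi_1 phi_antimono_rotation[of 1 r b 0] by (cases "r < 1") auto
  have "0 \<le> phi a (1 - a - b) t 0" if "t < - r" for t
  proof -
    have "- t \<notin> S"
      using that cSup_upper[OF _ bdd, of "- t"] by (auto simp: r_def)
    then show ?thesis
      using phi_reflect_le[of b "- t" 0] by (simp add: S_def)
  qed
  then have "0 \<le> phi a (1 - a - b) (- r) 0" by (rule phi_rotation_left_continuous)
  with \<open>0 \<le> r\<close> \<open>r < 1\<close> left show ?thesis by (rule that)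
qed

text \<open>The \<open>F_minus\<close> orbit of \<open>phi a b s 0\<close> is
  \<open>phi a b s (n * s)\<close>, which stays at bounded distance from
  \<open>n * s\<close>.\<close>

lemma rotation_number_unique:
  assumes semiconj: "\<And>u. F_minus a b (phi a b s u) = phi a b s (u + s)"
    and lim: "\<And>x. (\<lambda>n. (F_minus a b ^^ n) x / real n) \<longlonglongrightarrow> r"
  shows "s = r"
proof -
  have iter: "(F_minus a b ^^ n) (phi a b s 0) = phi a b s (real n * s)" for n
    by (induction n) (auto simp: semiconj algebra_simps)
  have "(\<lambda>n. (F_minus a b ^^ n) (phi a b s 0) / real n) \<longlonglongrightarrow> s"
  proof (rule tendsto_over_n_linear_bounds)
    fix n
    show "real n * s - (\<bar>phi a b s 0\<bar> + 1) \<le> (F_minus a b ^^ n) (phi a b s 0)"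
         "(F_minus a b ^^ n) (phi a b s 0) \<le> real n * s + (\<bar>phi a b s 0\<bar> + 1)"
      using phi_sub_bound[of b s "real n * s"] unfolding iter by linarith+
  qed
  with lim show ?thesis by (rule LIMSEQ_unique[rotated])
qed

end

subsection \<open>Quantile functions of invariant measures\<close>

text \<open>The strict inequality makes this the left-continuous distribution function, extended to
  the line with G(x + 1) = G(x) + 1. Left-continuity lets the suprema that define quantiles be
  attained.\<close>

definition lift_cdf :: "real measure \<Rightarrow> real \<Rightarrow> real" where
  "lift_cdf N x = of_int \<lfloor>x\<rfloor> + measure N {..<frac x}"

text \<open>The parameter \<open>b\<close> ranges over all reals because the locale is also
  instantiated with \<open>1 - a - b\<close>, which may be negative.\<close>

locale invariant_minus = contraction a + real_distribution N for a :: real and N +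
  fixes b :: real
  assumes inv: "A \<in> sets borel \<Longrightarrow> measure N (f_minus a b -` A) = measure N A"
begin

text \<open>All values of \<open>f_minus\<close> lie in [0,1), so invariance forces the whole mass
  there; in particular 1 is not an atom.\<close>

lemma prob_Ico_01: "measure N {0..<1} = 1"
proof -
  have "f_minus a b -` {0..<1} = UNIV"
    by (auto simp: f_minus_def frac_lt_1)
  then show ?thesis using inv[of "{0..<1}"] prob_space by simp
qed

lemma prob_Int_Ico_01:
  assumes "A \<in> sets borel"
  shows "measure N (A \<inter> {0..<1}) = measure N A"
proof (rule measure_eq_AE)
  have "AE x in N. x \<in> {0..<1}"
    using prob_Ico_01 by (subst AE_in_set_eq_1) auto
  then show "AE x in N. x \<in> A \<inter> {0..<1} \<longleftrightarrow> x \<in> A" by auto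
qed (use assms in auto)

lemma prob_eqI:
  assumes "A \<in> sets borel" "B \<in> sets borel" "A \<inter> {0..<1} = B \<inter> {0..<1}"
  shows "measure N A = measure N B"
  using arg_cong[OF assms(3), of "measure N"] by (simp only: prob_Int_Ico_01 assms(1,2))

lemma prob_lessThan_0: "t \<le> 0 \<Longrightarrow> measure N {..<t} = 0"
  by (rule trans[OF prob_eqI[of "{..<t}" "{}"]]) auto

lemma prob_lessThan_1: "measure N {..<1} = 1"
  by (rule trans[OF prob_eqI[of "{..<1}" "{0..<1}"] prob_Ico_01]) auto

lemma lift_cdf_add:
  assumes "0 \<le> t" "t \<le> 1"
  shows "lift_cdf N (of_int k + t) = of_int k + measure N {..<t}"
\<comment> \<open>At \<open>t = 1\<close> the fractional part wraps to 0, but the formula persists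
  since all mass lies in [0,1).\<close>
proof (cases "t = 1")
  case True
  then show ?thesis by (simp add: lift_cdf_def prob_lessThan_1 prob_lessThan_0)
next
  case False
  then have "\<lfloor>of_int k + t\<rfloor> = k" "frac (of_int k + t) = t"
    using assms by (auto simp: frac_eq intro: floor_unique)
  then show ?thesis by (simp add: lift_cdf_def)
qed

lemma lift_cdf_of_int: "lift_cdf N (of_int k) = of_int k"
  using lift_cdf_add[of 0 k] by (simp add: prob_lessThan_0)

lemma lift_cdf_add_of_int: "lift_cdf N (x + of_int k) = lift_cdf N x + of_int k"
  by (simp add: lift_cdf_def)

lemma lift_cdf_mono:
  assumes "x \<le> y"
  shows "lift_cdf N x \<le> lift_cdf N y"
proof (cases "\<lfloor>x\<rfloor> = \<lfloor>y\<rfloor>")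
  case True
  with assms have "frac x \<le> frac y" by (simp add: frac_def)
  then have "measure N {..<frac x} \<le> measure N {..<frac y}"
    by (intro finite_measure_mono) auto
  with True show ?thesis by (simp add: lift_cdf_def)
next
  case False
  with assms have "\<lfloor>x\<rfloor> + 1 \<le> \<lfloor>y\<rfloor>" using floor_mono[of x y] by linarith
  then have "of_int \<lfloor>x\<rfloor> + 1 \<le> (of_int \<lfloor>y\<rfloor> :: real)" by linarith
  moreover have "measure N {..<frac x} \<le> 1" "0 \<le> measure N {..<frac y}" by auto
  ultimately show ?thesis unfolding lift_cdf_def by linarith
qed

text \<open>The set on the right is the half-open arc of length \<open>l\<close> starting at
  \<open>c\<close> on the circle; the two cases are whether it passes the point 1.\<close>

lemma lift_cdf_diff:
  assumes "0 \<le> l" "l \<le> 1"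
  shows "lift_cdf N (c + l) - lift_cdf N c = measure N {t. frac (t - c) < l}"
proof -
  define k d where "k = \<lfloor>c\<rfloor>" and "d = frac c"
  have c: "c = of_int k + d" by (simp add: k_def d_def frac_def)
  have d: "0 \<le> d" "d < 1" by (simp_all add: d_def frac_lt_1)
  have frac_t: "frac (t - c) = (if d \<le> t then t - d else t - d + 1)" if "t \<in> {0..<1}" for t
  proof -
    have "t - c = (t - d) + of_int (- k)" by (simp add: c)
    then have "frac (t - c) = frac (t - d)" by (simp only: frac_add_of_int_right)
    also have "\<dots> = (if d \<le> t then t - d else t - d + 1)"
    proof (cases "d \<le> t")
      case True
      with that d show ?thesis by (simp add: frac_eq)
    next
      case False
      with that d have "frac (t - d + 1) = t - d + 1" by (simp add: frac_eq)
      with False show ?thesis by (simp only: frac_1_eq) simp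
    qed
    finally show ?thesis .
  qed
  have meas: "{t. frac (t - c) < l} \<in> sets borel"
    unfolding frac_def by measurable
  show ?thesis
  proof (cases "d + l \<le> 1")
    case True
    have "{t. frac (t - c) < l} \<inter> {0..<1} = ({..<d + l} - {..<d}) \<inter> {0..<1}"
    proof (rule set_eqI)
      fix t
      show "t \<in> {t. frac (t - c) < l} \<inter> {0..<1} \<longleftrightarrow> t \<in> ({..<d + l} - {..<d}) \<inter> {0..<1}"
        using True d frac_t[of t] by (cases "t \<in> {0..<1}"; cases "d \<le> t") auto
    qed
    then have "measure N {t. frac (t - c) < l} = measure N ({..<d + l} - {..<d})"
      by (intro prob_eqI[OF meas]) auto
    also have "\<dots> = measure N {..<d + l} - measure N {..<d}"
      using assms by (intro finite_measure_Diff) auto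
    finally show ?thesis
      using True d assms lift_cdf_add[of "d + l" k] lift_cdf_add[of d k]
      by (simp add: c add.assoc)
  next
    case False
    \<comment> \<open>An arc that wraps around is handled through its complement.\<close>
    have "{t. frac (t - c) < l} \<inter> {0..<1} = ({..<1} - {d + l - 1..<d}) \<inter> {0..<1}"
    proof (rule set_eqI)
      fix t
      show "t \<in> {t. frac (t - c) < l} \<inter> {0..<1} \<longleftrightarrow> t \<in> ({..<1} - {d + l - 1..<d}) \<inter> {0..<1}"
        using False d assms frac_t[of t] by (cases "t \<in> {0..<1}"; cases "d \<le> t") auto
    qed
    then have "measure N {t. frac (t - c) < l} = measure N ({..<1} - {d + l - 1..<d})"
      by (intro prob_eqI[OF meas]) auto
    also have "\<dots> = measure N {..<1} - measure N {d + l - 1..<d}"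
      using d by (intro finite_measure_Diff) auto
    also have "{d + l - 1..<d} = {..<d} - {..<d + l - 1}" by auto
    also have "measure N \<dots> = measure N {..<d} - measure N {..<d + l - 1}"
      using assms by (intro finite_measure_Diff) auto
    finally have *: "measure N {t. frac (t - c) < l} = 1 - (measure N {..<d} - measure N {..<d + l - 1})"
      by (simp add: prob_lessThan_1)
    have "lift_cdf N (c + l) = lift_cdf N (of_int (k + 1) + (d + l - 1))"
      by (simp add: c algebra_simps)
    also have "\<dots> = of_int (k + 1) + measure N {..<d + l - 1}"
      using False d assms by (intro lift_cdf_add) auto
    finally show ?thesis
      using * d lift_cdf_add[of d k] by (simp add: c)
  qed
qed

lemma frac_f_minus: "frac (f_minus a b x - c) = frac (a * x + b - c)"
proof -
  have "f_minus a b x - c = (a * x + b - c) + of_int (- \<lfloor>a * x + b\<rfloor>)"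
    by (simp add: f_minus_def frac_def)
  then show ?thesis by (simp only: frac_add_of_int_right)
qed

text \<open>Arcs do not see the integer by which \<open>f_minus\<close> differs from
  \<open>a * t + b\<close>, so invariance turns the mass of an arc into that of its preimage under
  an affine map.\<close>

lemma lift_cdf_diff_preimage:
  assumes "0 \<le> l" "l \<le> 1"
  shows "lift_cdf N (c + l) - lift_cdf N c = measure N {t. frac (a * t + b - c) < l}"
proof -
  have meas: "{t. frac (t - c) < l} \<in> sets borel"
    unfolding frac_def by measurable
  have "lift_cdf N (c + l) - lift_cdf N c = measure N (f_minus a b -` {t. frac (t - c) < l})"
    unfolding inv[OF meas] using assms by (rule lift_cdf_diff)
  also have "f_minus a b -` {t. frac (t - c) < l} = {t. frac (a * t + b - c) < l}"
    by (simp add: vimage_def frac_f_minus)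
  finally show ?thesis .
qed

text \<open>Within [0,1), the arc from \<open>b\<close> to \<open>b + a * t\<close> has preimage
  [0,t).\<close>

lemma lift_cdf_F_minus: "lift_cdf N (F_minus a b x) = lift_cdf N x + lift_cdf N b"
proof -
  define k t where "k = \<lfloor>x\<rfloor>" and "t = frac x"
  have x: "x = of_int k + t" by (simp add: k_def t_def frac_def)
  have t: "0 \<le> t" "t < 1" by (simp_all add: t_def frac_lt_1)
  have "a * t \<le> 1" using t a_pos a_less_1 by (intro mult_le_one) auto
  then have "lift_cdf N (b + a * t) - lift_cdf N b = measure N {s. frac (a * s + b - b) < a * t}"
    using t a_pos by (intro lift_cdf_diff_preimage) auto
  also have "\<dots> = measure N {..<t}"
  proof (rule prob_eqI)
    show "{s. frac (a * s + b - b) < a * t} \<in> sets borel" unfolding frac_def by measurable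
    have "frac (a * s) = a * s" if "0 \<le> s" "s < 1" for s
      using that a_pos a_less_1 mult_strict_mono[of a 1 s 1] by (auto simp: frac_eq)
    then show "{s. frac (a * s + b - b) < a * t} \<inter> {0..<1} = {..<t} \<inter> {0..<1}"
      using a_pos by auto
  qed simp
  finally have "lift_cdf N (b + a * t) = lift_cdf N b + measure N {..<t}" by simp
  moreover have "F_minus a b x = (b + a * t) + of_int k"
    by (simp add: F_minus_def flip: k_def) (simp add: x algebra_simps)
  ultimately show ?thesis
    using t lift_cdf_add[of t k] lift_cdf_add_of_int[of "b + a * t" k] by (simp add: x)
qed

text \<open>Modulo 1, the arc from \<open>a + b - 1\<close> to \<open>b\<close> is the complement of
  the image [b, a + b) of [0,1), so it carries no mass.\<close>

lemma lift_cdf_gap: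
  assumes "a + b - 1 \<le> y" "y \<le> b"
  shows "lift_cdf N y = lift_cdf N b"
proof -
  have "lift_cdf N ((a + b - 1) + (1 - a)) - lift_cdf N (a + b - 1)
      = measure N {t. frac (a * t + b - (a + b - 1)) < 1 - a}"
    using a_pos a_less_1 by (intro lift_cdf_diff_preimage) auto
  also have "\<dots> = measure N {}"
  proof (rule prob_eqI)
    show "{t. frac (a * t + b - (a + b - 1)) < 1 - a} \<in> sets borel"
      unfolding frac_def by measurable
    have "1 - a \<le> frac (a * t + b - (a + b - 1))" if "0 \<le> t" "t < 1" for t
    proof -
      have "a * t < a" using that a_pos by simp
      moreover have "0 \<le> a * t" using that a_pos by simp
      ultimately have "frac (a * t + (1 - a)) = a * t + (1 - a)"
        using a_less_1 by (simp add: frac_eq)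
      then show ?thesis using \<open>0 \<le> a * t\<close> by (simp add: algebra_simps)
    qed
    then show "{t. frac (a * t + b - (a + b - 1)) < 1 - a} \<inter> {0..<1} = {} \<inter> {0..<1}"
      by (auto simp: not_less[symmetric])
  qed auto
  finally have "lift_cdf N (a + b - 1) = lift_cdf N b" by (simp add: algebra_simps)
  then show ?thesis
    using lift_cdf_mono[OF assms(1)] lift_cdf_mono[OF assms(2)] by simp
qed

section \<open>Left-continuity and the quantile function\<close>

lemma lift_cdf_left_continuous:
  assumes le: "\<And>y. y < x \<Longrightarrow> lift_cdf N y \<le> u"
  shows "lift_cdf N x \<le> u"
proof -
  \<comment> \<open>The ceiling instead of the floor keeps \<open>t\<close> positive at integers, so
    that points just left of \<open>x\<close> lie in the same period.\<close>
  define k where "k = \<lceil>x\<rceil> - 1"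
  define t where "t = x - of_int k"
  have x: "x = of_int k + t" and t: "0 < t" "t \<le> 1"
    by (auto simp: k_def t_def) linarith+
  have "measure N {..<t} \<le> u - of_int k"
  proof (rule tendsto_upperbound[OF cdf_at_left])
    have "eventually (\<lambda>z. z \<in> {0<..<t}) (at_left t)"
      using t by (intro eventually_at_left_real) simp
    then show "eventually (\<lambda>z. cdf N z \<le> u - of_int k) (at_left t)"
    proof eventually_elim
      case (elim z)
      \<comment> \<open>\<open>cdf\<close> includes its endpoint and \<open>lift_cdf\<close>
        excludes it; an intermediate point bridges the two.\<close>
      define w where "w = (z + t) / 2"
      have w: "z < w" "w < t" using elim by (auto simp: w_def)
      have "cdf N z \<le> measure N {..<w}"
        unfolding cdf_def using w by (intro finite_measure_mono) auto
      also have "\<dots> = lift_cdf N (of_int k + w) - of_int k"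
        using elim w t by (subst lift_cdf_add) auto
      also have "\<dots> \<le> u - of_int k"
        using le[of "of_int k + w"] w x by simp
      finally show ?case .
    qed
  qed simp
  then show ?thesis
    using t lift_cdf_add[of t k] by (simp add: x)
qed

text \<open>Left-continuity puts the supremum of the sublevel set into the set. The resulting Galois
  connection lets \<open>lift_cdf\<close> and its quantile function determine each other.\<close>

lemma ex_quantile: "\<exists>q. \<forall>x. lift_cdf N x \<le> u \<longleftrightarrow> x \<le> q"
proof -
  define S where "S = {x. lift_cdf N x \<le> u}"
  have "of_int \<lfloor>u\<rfloor> \<in> S" by (simp add: S_def lift_cdf_of_int)
  then have ne: "S \<noteq> {}" by blast
  have "x \<le> of_int (\<lfloor>u\<rfloor> + 1)" if "x \<in> S" for x
  proof (rule ccontr)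
    assume "\<not> x \<le> of_int (\<lfloor>u\<rfloor> + 1)"
    then have "lift_cdf N (of_int (\<lfloor>u\<rfloor> + 1)) \<le> lift_cdf N x" by (intro lift_cdf_mono) auto
    with that show False
      unfolding lift_cdf_of_int S_def by simp linarith
  qed
  then have bdd: "bdd_above S" by (rule bdd_aboveI)
  have "lift_cdf N x \<le> u \<longleftrightarrow> x \<le> Sup S" for x
  proof
    assume "lift_cdf N x \<le> u"
    then show "x \<le> Sup S" using bdd by (intro cSup_upper) (auto simp: S_def)
  next
    assume "x \<le> Sup S"
    have "lift_cdf N y \<le> u" if "y < Sup S" for y
    proof -
      from that have "\<exists>z\<in>S. y < z" by (simp only: less_cSup_iff[OF ne bdd])
      then obtain z where "z \<in> S" "y < z" by blast
      then show ?thesis using lift_cdf_mono[of y z] by (simp add: S_def)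
    qed
    then have "lift_cdf N (Sup S) \<le> u" by (rule lift_cdf_left_continuous)
    with \<open>x \<le> Sup S\<close> show "lift_cdf N x \<le> u" by (rule order_trans[OF lift_cdf_mono])
  qed
  then show ?thesis by blast
qed

definition quantile :: "real \<Rightarrow> real" where
  "quantile u = (SOME q. \<forall>x. lift_cdf N x \<le> u \<longleftrightarrow> x \<le> q)"

lemma quantile: "lift_cdf N x \<le> u \<longleftrightarrow> x \<le> quantile u"
  unfolding quantile_def by (rule someI_ex[OF ex_quantile, THEN spec])

text \<open>\<open>lift_cdf\<close> fixes the integers. This replaces the floor of
  \<open>quantile u\<close> in \<open>F_minus\<close> by the floor of \<open>u\<close>, which makes
  the equation affine in the quantile.\<close>

lemma floor_quantile: "\<lfloor>quantile u\<rfloor> = \<lfloor>u\<rfloor>"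
proof (rule floor_unique)
  show "of_int \<lfloor>u\<rfloor> \<le> quantile u"
    by (simp flip: quantile add: lift_cdf_of_int)
  have "\<not> of_int (\<lfloor>u\<rfloor> + 1) \<le> quantile u"
    unfolding quantile[symmetric] lift_cdf_of_int by simp linarith
  then show "quantile u < of_int \<lfloor>u\<rfloor> + 1" by simp
qed

text \<open>One inequality is \<open>lift_cdf_F_minus\<close> read through the Galois connection.
  For the other, the quantile on the left is an image under \<open>F_minus\<close>, since a point in
  a gap of the image would not be maximal in its sublevel set.\<close>

lemma quantile_add_rotation: "quantile (u + lift_cdf N b) = F_minus a b (quantile u)"
proof (rule antisym)
  show "F_minus a b (quantile u) \<le> quantile (u + lift_cdf N b)"
    by (simp flip: quantile add: lift_cdf_F_minus) (simp add: quantile)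
  define y where "y = quantile (u + lift_cdf N b)"
  have y: "lift_cdf N y \<le> u + lift_cdf N b" by (simp add: quantile y_def)
  define k where "k = \<lfloor>y - b\<rfloor>"
  define t where "t = (y - b - of_int k) / a"
  have t: "y = a * t + b + of_int k" "0 \<le> t"
    using a_pos by (auto simp: t_def k_def)
  have at: "a * t < 1"
    using a_pos unfolding t_def k_def by simp linarith
  have "y \<le> F_minus a b (quantile u)"
  proof (cases "t < 1")
    case True
    then have "\<lfloor>of_int k + t\<rfloor> = k" using t by (intro floor_unique) auto
    then have eq: "y = F_minus a b (of_int k + t)"
      using t by (simp add: F_minus_def algebra_simps)
    with y have "of_int k + t \<le> quantile u"
      by (simp add: lift_cdf_F_minus quantile)
    then show ?thesis unfolding eq by (rule F_minus_mono)
  next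
    case False
    \<comment> \<open>Now \<open>y\<close> lies in the gap just below \<open>b + k + 1\<close>.
      \<open>lift_cdf\<close> is constant up to that point, so maximality of \<open>y\<close> gives
      \<open>b + k + 1 \<le> y\<close>, against \<open>a * t < 1\<close>.\<close>
    then have "a \<le> a * t" using a_pos by simp
    have "lift_cdf N (y + of_int (- k - 1)) = lift_cdf N b"
      using \<open>a \<le> a * t\<close> at by (intro lift_cdf_gap) (simp_all add: t(1))
    then have "lift_cdf N y = lift_cdf N (b + of_int (k + 1))"
      unfolding lift_cdf_add_of_int by simp
    with y have "lift_cdf N (b + of_int (k + 1)) \<le> u + lift_cdf N b" by simp
    then have "b + of_int (k + 1) \<le> y" unfolding quantile y_def .
    then show ?thesis using at t(1) by simp
  qed
  then show "quantile (u + lift_cdf N b) \<le> F_minus a b (quantile u)" by (simp add: y_def)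
qed

lemma quantile_eq_phi: "quantile u = phi a b (lift_cdf N b) u"
proof (rule phi_unique)
  show "quantile (v + lift_cdf N b) = a * quantile v + b + (1 - a) * of_int \<lfloor>v\<rfloor>" for v
    by (simp add: quantile_add_rotation F_minus_def floor_quantile)
  show "\<bar>quantile v - v\<bar> \<le> 1" for v
    using floor_quantile[of v] by linarith
qed

lemma lift_cdf_le_iff_phi:
  assumes "\<And>x. (\<lambda>n. (F_minus a b ^^ n) x / real n) \<longlonglongrightarrow> r"
  shows "lift_cdf N x \<le> u \<longleftrightarrow> x \<le> phi a b r u"
proof -
  have "lift_cdf N b = r"
    by (rule rotation_number_unique[OF _ assms])
       (simp add: quantile_add_rotation flip: quantile_eq_phi)
  then have "phi a b r u = quantile u" by (simp only: quantile_eq_phi)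
  then show ?thesis by (simp only: quantile)
qed

end

subsection \<open>Uniqueness of the invariant measure\<close>

lemma f_minus_Ico: "f_minus a b x \<in> {0..<1}"
  by (simp add: f_minus_def frac_lt_1)

lemma f_plus_Ioc: "f_plus a b x \<in> {0<..1}"
  using frac_lt_1[of "- (a * x + b)"] frac_ge_0[of "- (a * x + b)"]
  by (simp add: f_plus_def frac_pos_def del: minus_add_distrib frac_ge_0)

lemma f_plus_reflect: "f_plus a b (1 - y) = 1 - f_minus a (1 - a - b) y"
proof -
  have "frac (- (a * (1 - y) + b)) = frac (- (a * (1 - y) + b) + 1)" by (simp only: frac_1_eq)
  also have "- (a * (1 - y) + b) + 1 = a * y + (1 - a - b)" by (simp add: algebra_simps)
  finally show ?thesis by (simp add: f_plus_def frac_pos_def f_minus_def)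
qed

lemma space_unit_borel: "space unit_borel = {0..1}"
  by (simp add: unit_borel_def space_restrict_space)

lemma sets_unit_borel_iff: "A \<in> sets unit_borel \<longleftrightarrow> A \<in> sets borel \<and> A \<subseteq> {0..1}"
  unfolding unit_borel_def by (subst sets_restrict_space_iff) auto

lemma space_borel_prob_on_unit: "borel_prob_on_unit \<nu> \<Longrightarrow> space \<nu> = {0..1}"
  using sets_eq_imp_space_eq[of \<nu> unit_borel] by (simp add: borel_prob_on_unit_def space_unit_borel)

lemma measurable_borel_prob_on_unit:
  assumes "borel_prob_on_unit \<nu>" "f \<in> borel_measurable borel"
  shows "f \<in> borel_measurable \<nu>"
proof -
  have "f \<in> borel_measurable unit_borel"
    unfolding unit_borel_def using assms(2) by (rule measurable_restrict_space1)
  then show ?thesis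
    using assms(1) by (simp add: borel_prob_on_unit_def cong: measurable_cong_sets)
qed

lemma measure_distr_borel_prob_on_unit:
  assumes "borel_prob_on_unit \<nu>" "f \<in> borel_measurable borel" "A \<in> sets borel"
  shows "measure (distr \<nu> borel f) A = measure \<nu> (f -` A \<inter> {0..1})"
  using assms by (simp add: measure_distr measurable_borel_prob_on_unit space_borel_prob_on_unit)

lemma real_distribution_distr_unit:
  assumes "borel_prob_on_unit \<nu>" "f \<in> borel_measurable borel"
  shows "real_distribution (distr \<nu> borel f)"
  using assms measurable_borel_prob_on_unit[OF assms]
  by (intro prob_space.real_distribution_distr) (auto simp: borel_prob_on_unit_def)

lemma invariant_under_measure:
  assumes "borel_prob_on_unit \<nu>" "invariant_under f \<nu>" "A \<in> sets borel"
  shows "measure \<nu> (f -` A \<inter> {0..1}) = measure \<nu> (A \<inter> {0..1})"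
proof -
  have "A \<inter> {0..1} \<in> sets \<nu>"
    using assms by (simp add: borel_prob_on_unit_def sets_unit_borel_iff)
  with assms(2) have "emeasure \<nu> (f -` (A \<inter> {0..1}) \<inter> space \<nu>) = emeasure \<nu> (A \<inter> {0..1})"
    unfolding invariant_under_def by blast
  moreover have "f x \<in> {0..1}" if "x \<in> {0..1}" for x
    using assms(1,2) that unfolding invariant_under_def measurable_def
    by (auto simp: space_borel_prob_on_unit)
  then have "f -` (A \<inter> {0..1}) \<inter> space \<nu> = f -` A \<inter> {0..1}"
    using assms(1) by (auto simp: space_borel_prob_on_unit)
  ultimately show ?thesis by (simp add: measure_def)
qed

lemma borel_measurable_f_minus: "f_minus a b \<in> borel_measurable borel"
  unfolding f_minus_def frac_def by measurable

context contraction
begin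

lemma invariant_minus_distr:
  assumes "borel_prob_on_unit \<nu>" "invariant_under (f_minus a b) \<nu>"
  shows "invariant_minus a (distr \<nu> borel (\<lambda>x. x)) b"
proof -
  interpret real_distribution "distr \<nu> borel (\<lambda>x. x)"
    using assms by (intro real_distribution_distr_unit) auto
  show ?thesis
  proof
    fix A :: "real set" assume A: "A \<in> sets borel"
    then have "f_minus a b -` A \<in> sets borel"
      using measurable_sets[OF borel_measurable_f_minus A] by simp
    with A assms invariant_under_measure[OF assms A]
    show "measure (distr \<nu> borel (\<lambda>x. x)) (f_minus a b -` A) = measure (distr \<nu> borel (\<lambda>x. x)) A"
      by (simp add: measure_distr_borel_prob_on_unit)
  qed
qed

lemma invariant_minus_distr_reflect:
  assumes "borel_prob_on_unit \<nu>" "invariant_under (f_plus a b) \<nu>"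
  shows "invariant_minus a (distr \<nu> borel (\<lambda>x. 1 - x)) (1 - a - b)"
proof -
  interpret real_distribution "distr \<nu> borel (\<lambda>x. 1 - x)"
    using assms by (intro real_distribution_distr_unit) auto
  show ?thesis
  proof
    fix A :: "real set" assume A: "A \<in> sets borel"
    have f: "f_minus a (1 - a - b) -` A \<in> sets borel"
      using measurable_sets[OF borel_measurable_f_minus A] by simp
    have refl: "(\<lambda>x. 1 - x) -` A \<in> sets borel"
      using measurable_sets[OF _ A, of "\<lambda>x. 1 - x" borel] by simp
    have "f_minus a (1 - a - b) (1 - x) = 1 - f_plus a b x" for x
      using f_plus_reflect[of a b "1 - x"] by simp
    then have "(\<lambda>x. 1 - x) -` (f_minus a (1 - a - b) -` A) = f_plus a b -` ((\<lambda>x. 1 - x) -` A)"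
      by auto
    moreover have "(\<lambda>x. 1 - x) \<in> borel_measurable (borel :: real measure)" by measurable
    note measure_distr_borel_prob_on_unit[OF assms(1) this]
    ultimately show "measure (distr \<nu> borel (\<lambda>x. 1 - x)) (f_minus a (1 - a - b) -` A)
        = measure (distr \<nu> borel (\<lambda>x. 1 - x)) A"
      using A f invariant_under_measure[OF assms refl] by simp
  qed
qed

text \<open>The bounds have the same form as in \<open>cdf_bounds_f_plus\<close>, so that measures
  invariant under different maps can be compared. They follow from the quantile characterization,
  with right-continuity of \<open>cdf\<close> making up for the excluded endpoint in
  \<open>lift_cdf\<close>.\<close>

lemma cdf_bounds_f_minus:
  assumes \<nu>: "borel_prob_on_unit \<nu>" "invariant_under (f_minus a b) \<nu>"
    and r: "is_rotation_number a b r" and x: "0 \<le> x" "x < 1"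
  shows "phi a b r u \<le> x \<Longrightarrow> u \<le> cdf (distr \<nu> borel (\<lambda>x. x)) x"
    and "x < - phi a (1 - a - b) (- r) (- u) \<Longrightarrow> cdf (distr \<nu> borel (\<lambda>x. x)) x \<le> u"
proof -
  let ?N = "distr \<nu> borel (\<lambda>x. x)"
  interpret invariant_minus a ?N b by (rule invariant_minus_distr[OF \<nu>])
  have G: "measure ?N {..<y} \<le> v \<longleftrightarrow> y \<le> phi a b r v" if "0 \<le> y" "y \<le> 1" for y v
    using lift_cdf_le_iff_phi[of r y v] r that lift_cdf_add[of y 0]
    by (simp add: is_rotation_number_def)
  {
    assume "phi a b r u \<le> x"
    have "eventually (\<lambda>y. y \<in> {x<..<1}) (at_right x)"
      using x by (intro eventually_at_right_real)
    then have "eventually (\<lambda>y. u \<le> cdf ?N y) (at_right x)"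
    proof eventually_elim
      case (elim y)
      with \<open>phi a b r u \<le> x\<close> x have "u \<le> measure ?N {..<y}"
        using G[of y u] by auto
      also have "\<dots> \<le> cdf ?N y"
        unfolding cdf_def by (intro finite_measure_mono) auto
      finally show ?case .
    qed
    moreover have "(cdf ?N \<longlongrightarrow> cdf ?N x) (at_right x)"
      using cdf_is_right_cont[of x] by (simp add: continuous_within)
    ultimately show "u \<le> cdf ?N x"
      by (intro tendsto_lowerbound) auto
  next
    assume *: "x < - phi a (1 - a - b) (- r) (- u)"
    define y where "y = min (- phi a (1 - a - b) (- r) (- u)) 1"
    have y: "x < y" "y \<le> 1" using * x by (auto simp: y_def)
    have "y \<le> phi a b r u" using phi_reflect_le[of b r u] by (simp add: y_def)
    have "cdf ?N x \<le> measure ?N {..<y}"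
      unfolding cdf_def using y by (intro finite_measure_mono) auto
    also have "\<dots> \<le> u" using \<open>y \<le> phi a b r u\<close> G[of y u] x y by auto
    finally show "cdf ?N x \<le> u" .
  }
qed

lemma cdf_bounds_f_plus:
  assumes \<nu>: "borel_prob_on_unit \<nu>" "invariant_under (f_plus a b) \<nu>"
    and r: "is_rotation_number a b r" and x: "0 \<le> x" "x < 1"
  shows "phi a b r u \<le> x \<Longrightarrow> u \<le> cdf (distr \<nu> borel (\<lambda>x. x)) x"
    and "x < - phi a (1 - a - b) (- r) (- u) \<Longrightarrow> cdf (distr \<nu> borel (\<lambda>x. x)) x \<le> u"
proof -
  let ?N = "distr \<nu> borel (\<lambda>x. x)"
  let ?N' = "distr \<nu> borel (\<lambda>x. 1 - x)"
  interpret N': invariant_minus a ?N' "1 - a - b" by (rule invariant_minus_distr_reflect[OF \<nu>])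
  interpret N: real_distribution ?N
    using \<nu> by (intro real_distribution_distr_unit) auto
  have lim: "(\<lambda>n. (F_minus a (1 - a - b) ^^ n) y / real n) \<longlonglongrightarrow> - r" for y
  proof -
    have "(\<lambda>n. - ((F_plus a b ^^ n) (- y) / real n)) \<longlonglongrightarrow> - r"
      using r by (intro tendsto_minus) (simp add: is_rotation_number_def)
    then show ?thesis by (simp add: F_plus_funpow_reflect)
  qed
  have "cdf ?N x = 1 - measure ?N (UNIV - {..x})"
    using N.prob_compl[of "{..x}"] by (simp add: cdf_def)
  also have "UNIV - {..x} = {x<..}" by auto
  also have "measure ?N {x<..} = measure ?N' {..<1 - x}"
    using \<nu>(1) by (simp add: measure_distr_borel_prob_on_unit vimage_def) (simp add: greaterThan_def)
  \<comment> \<open>With \<open>1 - x\<close> written as the fractional position above the integer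
    -1, the complement becomes a value of the lifted distribution function of the reflected
    measure.\<close>
  also have "1 - measure ?N' {..<1 - x} = - lift_cdf ?N' (- x)"
    using N'.lift_cdf_add[of "1 - x" "- 1"] x by simp
  finally have "u \<le> cdf ?N x \<longleftrightarrow> - phi a (1 - a - b) (- r) (- u) \<le> x" for u
    using N'.lift_cdf_le_iff_phi[OF lim, of "- x" "- u"] by auto
  note iff = this
  show "u \<le> cdf ?N x" if "phi a b r u \<le> x"
    using that phi_reflect_le[of b r u] by (simp add: iff)
  show "cdf ?N x \<le> u" if "x < - phi a (1 - a - b) (- r) (- u)"
    using that iff[of u] by linarith
qed

lemma invariant_unique:
  assumes b: "0 \<le> b" "b < 1"
    and \<nu>: "borel_prob_on_unit \<nu>" "invariant_under (f_minus a b) \<nu> \<or> invariant_under (f_plus a b) \<nu>"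
    and \<nu>': "borel_prob_on_unit \<nu>'" "invariant_under (f_minus a b) \<nu>' \<or> invariant_under (f_plus a b) \<nu>'"
  shows "\<nu> = \<nu>'"
proof -
  let ?D = "\<lambda>\<nu>. distr \<nu> borel (\<lambda>x. x)"
  obtain r where "0 \<le> r" "r < 1" "0 \<le> phi a b r 0" "0 \<le> phi a (1 - a - b) (- r) 0"
    by (rule ex_phi_0_nonneg[OF b])
  then have r: "is_rotation_number a b r" by (rule is_rotation_numberI)
  have bounds: "(phi a b r u \<le> x \<longrightarrow> u \<le> cdf (?D \<kappa>) x) \<and>
      (x < - phi a (1 - a - b) (- r) (- u) \<longrightarrow> cdf (?D \<kappa>) x \<le> u)"
    if "borel_prob_on_unit \<kappa>" "invariant_under (f_minus a b) \<kappa> \<or> invariant_under (f_plus a b) \<kappa>"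
      "0 \<le> x" "x < 1" for \<kappa> u x
    using that(2)
  proof
    assume "invariant_under (f_minus a b) \<kappa>"
    from cdf_bounds_f_minus[OF that(1) this r that(3,4), of u] show ?thesis by blast
  next
    assume "invariant_under (f_plus a b) \<kappa>"
    from cdf_bounds_f_plus[OF that(1) this r that(3,4), of u] show ?thesis by blast
  qed
  have le: "cdf (?D \<kappa>) x \<le> cdf (?D \<kappa>') x"
    if \<kappa>: "borel_prob_on_unit \<kappa>" "invariant_under (f_minus a b) \<kappa> \<or> invariant_under (f_plus a b) \<kappa>"
      and \<kappa>': "borel_prob_on_unit \<kappa>'" "invariant_under (f_minus a b) \<kappa>' \<or> invariant_under (f_plus a b) \<kappa>'"
    for \<kappa> \<kappa>' x
  proof -
    interpret D: real_distribution "?D \<kappa>" using \<kappa> by (intro real_distribution_distr_unit) auto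
    interpret D': real_distribution "?D \<kappa>'" using \<kappa>' by (intro real_distribution_distr_unit) auto
    consider "x < 0" | "0 \<le> x" "x < 1" | "1 \<le> x" by linarith
    then show ?thesis
    proof cases
      case 1
      then have "{..x} \<inter> {0..1} = {}" by auto
      then have "cdf (?D \<kappa>) x = 0"
        using \<kappa> by (simp add: cdf_def measure_distr_borel_prob_on_unit)
      then show ?thesis by (simp add: D'.cdf_nonneg)
    next
      case 2
      show ?thesis
      proof (rule ccontr)
        assume "\<not> ?thesis"
        \<comment> \<open>Two levels are needed: the two versions of \<open>phi\<close> may differ
          at a single level, but between \<open>u\<close> and \<open>v\<close> they are ordered by
          \<open>phi_le_reflect\<close>.\<close>
        then obtain u v where uv: "cdf (?D \<kappa>') x < u" "u < v" "v < cdf (?D \<kappa>) x"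
          by (meson dense not_le)
        have "x < phi a b r u" using bounds[OF \<kappa>' 2, of u] uv by linarith
        also have "\<dots> \<le> - phi a (1 - a - b) (- r) (- v)" using uv(2) by (rule phi_le_reflect)
        finally have "cdf (?D \<kappa>) x \<le> v" using bounds[OF \<kappa> 2, of v] by blast
        with uv show False by simp
      qed
    next
      case 3
      then have "{..x} \<inter> {0..1} = space \<kappa>'"
        using \<kappa>' by (auto simp: space_borel_prob_on_unit)
      then have "cdf (?D \<kappa>') x = 1"
        using \<kappa>' by (simp add: cdf_def measure_distr_borel_prob_on_unit borel_prob_on_unit_def prob_space.prob_space)
      then show ?thesis by (simp add: D.cdf_bounded_prob)
    qed
  qed
  have "cdf (?D \<nu>) = cdf (?D \<nu>')"
    using le[OF \<nu> \<nu>'] le[OF \<nu>' \<nu>] by (intro ext antisym)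
  then have D_eq: "?D \<nu> = ?D \<nu>'"
    using \<nu> \<nu>' by (intro cdf_unique real_distribution_distr_unit) auto
  show ?thesis
  proof (rule measure_eqI)
    show "sets \<nu> = sets \<nu>'" using \<nu> \<nu>' by (simp add: borel_prob_on_unit_def)
    fix A assume "A \<in> sets \<nu>"
    then have A: "A \<in> sets borel" "A \<subseteq> {0..1}"
      using \<nu> by (auto simp: borel_prob_on_unit_def sets_unit_borel_iff)
    have "emeasure \<kappa> A = emeasure (?D \<kappa>) A" if "borel_prob_on_unit \<kappa>" for \<kappa>
      using that A
      by (simp add: emeasure_distr measurable_borel_prob_on_unit space_borel_prob_on_unit Int_absorb2)
    then show "emeasure \<nu> A = emeasure \<nu>' A" using \<nu> \<nu>' D_eq by metis
  qed
qed

end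

subsection \<open>Existence of the invariant measure\<close>

text \<open>The rational case of \<open>mu\<close> with an arbitrary set, so that orbits can be
  compared before \<open>periodic_set\<close> is known to be well defined.\<close>

definition unif :: "real set \<Rightarrow> real measure" where
  "unif C = distr (uniform_count_measure C) unit_borel (\<lambda>x. x)"

lemma measurable_uniform_count_unit:
  "C \<subseteq> {0..1} \<Longrightarrow> (\<lambda>x. x) \<in> measurable (uniform_count_measure C) unit_borel"
  by (auto simp: measurable_def space_uniform_count_measure sets_uniform_count_measure space_unit_borel)

lemma sets_unif: "sets (unif C) = sets unit_borel"
  by (simp add: unif_def)

lemma borel_prob_on_unit_unif:
  assumes "finite C" "C \<noteq> {}" "C \<subseteq> {0..1}"
  shows "borel_prob_on_unit (unif C)"
  using assms measurable_uniform_count_unit[OF assms(3)]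
  by (auto simp: borel_prob_on_unit_def unif_def
      intro!: prob_space.prob_space_distr prob_space_uniform_count_measure)

lemma emeasure_unif:
  assumes "finite C" "C \<noteq> {}" "C \<subseteq> {0..1}" "A \<in> sets unit_borel"
  shows "emeasure (unif C) A = ennreal (real (card (A \<inter> C)) / real (card C))"
  using assms measurable_uniform_count_unit[OF assms(3)]
  by (simp add: unif_def emeasure_distr space_uniform_count_measure emeasure_uniform_count_measure)

text \<open>Points of \<open>C\<close> are atoms of positive mass, hence atoms of the other measure
  too.\<close>

lemma unif_subset:
  assumes C: "finite C" "C \<noteq> {}" "C \<subseteq> {0..1}" and D: "finite D" "D \<noteq> {}" "D \<subseteq> {0..1}"
    and eq: "unif C = unif D"
  shows "C \<subseteq> D"
proof
  fix x assume x: "x \<in> C"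
  have "{x} \<in> sets unit_borel" using x C by (auto simp: sets_unit_borel_iff)
  then have "ennreal (real (card ({x} \<inter> C)) / real (card C)) = ennreal (real (card ({x} \<inter> D)) / real (card D))"
    using emeasure_unif[OF C, of "{x}"] emeasure_unif[OF D, of "{x}"] eq by simp
  then have "real (card ({x} \<inter> C)) / real (card C) = real (card ({x} \<inter> D)) / real (card D)"
    by (subst (asm) ennreal_inj) auto
  moreover have "0 < real (card ({x} \<inter> C)) / real (card C)"
    using x C by (simp add: card_gt_0_iff)
  ultimately have "0 < real (card ({x} \<inter> D)) / real (card D)" by (simp only:)
  then show "x \<in> D" by (cases "x \<in> D") simp_all
qed

text \<open>A map of a finite set onto itself permutes it, so preimages keep their number of points
  in \<open>C\<close>.\<close>

lemma invariant_under_unif: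
  assumes C: "finite C" "C \<noteq> {}" "C \<subseteq> {0..1}"
    and f: "f \<in> measurable unit_borel unit_borel" and img: "f ` C = C"
  shows "invariant_under f (unif C)"
  unfolding invariant_under_def
proof
  show "f \<in> measurable (unif C) (unif C)"
    using f by (simp add: sets_unif cong: measurable_cong_sets)
  have inj: "inj_on f C" using C(1) img by (intro finite_surj_inj) auto
  show "\<forall>A\<in>sets (unif C). emeasure (unif C) (f -` A \<inter> space (unif C)) = emeasure (unif C) A"
  proof
    fix A assume "A \<in> sets (unif C)"
    then have A: "A \<in> sets unit_borel" by (simp add: sets_unif)
    have sp: "space (unif C) = {0..1}" by (simp add: unif_def space_unit_borel)
    have meas: "f -` A \<inter> {0..1} \<in> sets unit_borel"
      using measurable_sets[OF f A] by (simp add: space_unit_borel)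
    have "f ` (f -` A \<inter> {0..1} \<inter> C) = A \<inter> f ` C"
      using C(3) by blast
    then have "f ` (f -` A \<inter> {0..1} \<inter> C) = A \<inter> C" by (simp only: img)
    moreover have "inj_on f (f -` A \<inter> {0..1} \<inter> C)"
      using inj by (rule inj_on_subset) auto
    ultimately have "card (f -` A \<inter> {0..1} \<inter> C) = card (A \<inter> C)"
      using card_image by metis
    then show "emeasure (unif C) (f -` A \<inter> space (unif C)) = emeasure (unif C) A"
      using emeasure_unif[OF C A] emeasure_unif[OF C meas] by (simp add: sp)
  qed
qed

section \<open>Periodic sequences and returns to a point\<close>

lemma periodic_mod:
  fixes x :: "nat \<Rightarrow> 'a"
  assumes "\<And>n. x (n + q) = x n"
  shows "x n = x (n mod q)"
proof -
  have "x (m + k * q) = x m" for m k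
    by (induction k) (use assms[of "m + _ * q"] in \<open>auto simp: ac_simps\<close>)
  from this[of "n mod q" "n div q"] show ?thesis by simp
qed

lemma periodic_range:
  fixes x :: "nat \<Rightarrow> 'a"
  assumes "1 \<le> q" "\<And>n. x (n + q) = x n" "\<And>n. x (Suc n) = f (x n)"
  shows "finite (range x)" "f ` range x = range x"
proof -
  have "range x \<subseteq> x ` {..<q}"
  proof
    fix y assume "y \<in> range x"
    then obtain n where "y = x n" by blast
    then have "y = x (n mod q)" using periodic_mod[of x q n] assms(2) by simp
    moreover have "n mod q < q" using assms(1) by simp
    ultimately show "y \<in> x ` {..<q}" by blast
  qed
  then show "finite (range x)" by (rule finite_subset) simp
  have "x n \<in> f ` range x" for n
  proof -
    have "x n = x (Suc (n + q - 1))" using assms(1,2) by simp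
    also have "\<dots> = f (x (n + q - 1))" by (rule assms(3))
    finally show ?thesis by simp
  qed
  then show "f ` range x = range x" using assms(3) by auto (metis rangeI)
qed

text \<open>Cutting a periodic orbit at consecutive visits of \<open>c\<close> turns one that follows \<open>g\<close> at some
  visit into a periodic orbit of \<open>g\<close>.\<close>

lemma ex_funpow_return:
  fixes x :: "nat \<Rightarrow> 'a"
  assumes "x j = c" "1 \<le> q" "x (j + q) = c" "x (Suc j) = g c"
    and step: "\<And>n. x n \<noteq> c \<Longrightarrow> x (Suc n) = g (x n)"
  shows "\<exists>m\<ge>1. (g ^^ m) c = c"
proof -
  \<comment> \<open>The first return after \<open>j\<close>: strictly in between, the orbit avoids
    \<open>c\<close>, so every step is a step of \<open>g\<close>.\<close>
  define m where "m = (LEAST m. 1 \<le> m \<and> x (j + m) = c)"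
  have m: "1 \<le> m \<and> x (j + m) = c"
    unfolding m_def by (rule LeastI[of _ q]) (use assms in auto)
  have before: "x (j + k) \<noteq> c" if "1 \<le> k" "k < m" for k
    using that not_less_Least[of k "\<lambda>m. 1 \<le> m \<and> x (j + m) = c"] by (auto simp: m_def)
  have "k \<le> m \<longrightarrow> (g ^^ k) c = x (j + k)" for k
  proof (induction k)
    case (Suc k)
    show ?case
    proof (cases "k = 0")
      case False
      then show ?thesis using Suc before[of k] step[of "j + k"] by auto
    qed (use assms in auto)
  qed (use assms in auto)
  from this[of m] m show ?thesis by auto
qed

lemma f_minus_neq_f_plus:
  assumes "f_minus a b x \<noteq> f_plus a b x"
  shows "a * x + b \<in> \<int>" "f_minus a b x = 0" "f_plus a b x = 1"
proof -
  show *: "a * x + b \<in> \<int>"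
  proof (rule ccontr)
    assume "a * x + b \<notin> \<int>"
    then have "f_plus a b x = f_minus a b x"
      unfolding f_plus_def f_minus_def frac_pos_def frac_neg by simp
    with assms show False by simp
  qed
  then show "f_minus a b x = 0" by (simp add: f_minus_def)
  from * have "- (a * x + b) \<in> \<int>" by (rule Ints_minus)
  then show "f_plus a b x = 1" by (simp add: f_plus_def frac_pos_def del: minus_add_distrib)
qed

lemma emeasure_lborel_Int_01:
  assumes "B \<in> sets borel"
  shows "emeasure lborel (B \<inter> {0..1}) = emeasure lborel (B \<inter> {0..<1::real})"
proof (rule emeasure_eq_AE)
  show "AE x in lborel. (x \<in> B \<inter> {0..1}) = (x \<in> B \<inter> {0..<1})"
    using AE_lborel_singleton[of 1] by eventually_elim auto
qed (use assms in auto)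

lemma emeasure_lborel_vimage_plus:
  assumes "B \<in> sets borel"
  shows "emeasure lborel ((\<lambda>x. c + x) -` B) = emeasure lborel (B :: real set)"
proof -
  have "emeasure lborel B = emeasure (distr lborel borel ((+) c)) B"
    by (simp add: lborel_distr_plus)
  also have "\<dots> = emeasure lborel ((+) c -` B)"
    using assms by (subst emeasure_distr) auto
  finally show ?thesis by (simp add: vimage_def)
qed

text \<open>The rotation exchanges two intervals: [0, 1 - r) is translated by \<open>r\<close>, and
  [1 - r, 1) by \<open>r - 1\<close>.\<close>

lemma emeasure_lborel_rotation:
  assumes B: "B \<in> sets borel" and r: "0 \<le> r" "r < 1"
  shows "emeasure lborel ({x. frac (x + r) \<in> B} \<inter> {0..<1}) = emeasure lborel (B \<inter> {0..<1::real})"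
proof -
  have low: "frac (x + r) = r + x" if "0 \<le> x" "x < 1 - r" for x
    using that r by (simp add: frac_eq add.commute)
  have high: "frac (x + r) = (r - 1) + x" if "1 - r \<le> x" "x < 1" for x
  proof -
    have "frac ((r - 1 + x) + 1) = frac (r - 1 + x)" by (rule frac_1_eq)
    also have "\<dots> = r - 1 + x" using that r by (simp add: frac_eq)
    finally show ?thesis by (simp add: add.commute)
  qed
  have meas: "(\<lambda>x. c + x) -` D \<in> sets borel" if "D \<in> sets borel" for c :: real and D
    using measurable_sets[of "\<lambda>x. c + x" borel borel D] that by simp
  have "{x. frac (x + r) \<in> B} \<inter> {0..<1} =
      (\<lambda>x. r + x) -` (B \<inter> {r..<1}) \<union> (\<lambda>x. (r - 1) + x) -` (B \<inter> {0..<r})"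
  proof (rule set_eqI)
    fix x
    show "x \<in> {x. frac (x + r) \<in> B} \<inter> {0..<1} \<longleftrightarrow>
        x \<in> (\<lambda>x. r + x) -` (B \<inter> {r..<1}) \<union> (\<lambda>x. (r - 1) + x) -` (B \<inter> {0..<r})"
      using low[of x] high[of x] r
      by (cases "0 \<le> x"; cases "x < 1"; cases "x < 1 - r") (auto simp: add.commute[of x r])
  qed
  also have "emeasure lborel \<dots> =
      emeasure lborel ((\<lambda>x. r + x) -` (B \<inter> {r..<1})) + emeasure lborel ((\<lambda>x. (r - 1) + x) -` (B \<inter> {0..<r}))"
    using B by (intro plus_emeasure[symmetric]) (auto intro!: meas)
  also have "\<dots> = emeasure lborel (B \<inter> {r..<1}) + emeasure lborel (B \<inter> {0..<r})"
    using B by (subst (1 2) emeasure_lborel_vimage_plus) auto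
  also have "\<dots> = emeasure lborel ((B \<inter> {r..<1}) \<union> (B \<inter> {0..<r}))"
    using B by (intro plus_emeasure) auto
  also have "(B \<inter> {r..<1}) \<union> (B \<inter> {0..<r}) = B \<inter> {0..<1}" using r by auto
  finally show ?thesis .
qed

context contraction
begin

text \<open>The hypotheses make \<open>phi\<close> map [0,1) into itself, so the semiconjugacy of
  the lifts descends to the unit interval.\<close>

lemma f_minus_phi:
  assumes nonneg: "0 \<le> phi a b r 0" and less: "\<And>x. x < 1 \<Longrightarrow> phi a b r x < 1"
    and t: "0 \<le> t" "t < 1"
  shows "f_minus a b (phi a b r t) = phi a b r (frac (t + r))"
proof -
  have "\<lfloor>t\<rfloor> = 0" using t by (intro floor_unique) auto
  then have "f_minus a b (phi a b r t) = frac (phi a b r (t + r))"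
    by (simp add: f_minus_def phi_add_rotation)
  also have "phi a b r (t + r) = phi a b r (frac (t + r)) + of_int \<lfloor>t + r\<rfloor>"
    using phi_add_of_int[of b r "frac (t + r)" "\<lfloor>t + r\<rfloor>"] by (simp add: frac_def)
  also have "frac \<dots> = frac (phi a b r (frac (t + r)))" by (simp only: frac_add_of_int_right)
  also have "\<dots> = phi a b r (frac (t + r))"
    unfolding frac_eq
    using nonneg phi_mono[of 0 "frac (t + r)" b r] less[of "frac (t + r)"]
    by (simp add: frac_lt_1)
  finally show ?thesis .
qed

text \<open>Decides which of the two maps carries the periodic orbit. If \<open>phi\<close> reaches
  1 before 1, it is positive at 0 by strictness; if the reflected function also does so at
  \<open>y\<close>, then \<open>phi_le_reflect\<close> bounds \<open>phi\<close> at 0 by a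
  nonpositive number.\<close>

lemma phi_less_1_cases:
  assumes "0 \<le> phi a b r 0" "0 \<le> phi a (1 - a - b) (- r) 0"
  shows "(\<forall>x<1. phi a b r x < 1) \<or> (\<forall>x<1. phi a (1 - a - b) (- r) x < 1)"
proof (rule ccontr)
  assume "\<not> ?thesis"
  then obtain x y where x: "x < 1" "1 \<le> phi a b r x"
    and y: "y < 1" "1 \<le> phi a (1 - a - b) (- r) y"
    by (auto simp: not_less)
  have "0 < phi a b r 0"
    using phi_strict_at_1[OF x(1), of b r] phi_add_1[of b r 0] x(2) by simp
  also have "\<dots> \<le> - phi a (1 - a - b) (- r) (- (1 - y))"
    using y(1) by (intro phi_le_reflect) simp
  finally show False
    using y(2) phi_add_1[of "1 - a - b" "- r" "y - 1"] by simp
qed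

text \<open>The two sign conditions and \<open>phi_reflect_eq_0\<close> force \<open>phi\<close> to
  vanish at 0, hence to equal 1 at 1.\<close>

lemma phi_less_1_irrational:
  assumes "0 \<le> phi a b r 0" "0 \<le> phi a (1 - a - b) (- r) 0" "r \<notin> \<rat>" "x < 1"
  shows "phi a b r x < 1"
  using assms phi_reflect_eq_0[OF assms(3), of b] phi_strict_at_1[OF assms(4), of b r] phi_add_1[of b r 0]
  by simp

lemma f_minus_funpow_phi_0:
  assumes "0 \<le> phi a b r 0" "\<And>x. x < 1 \<Longrightarrow> phi a b r x < 1"
  shows "(f_minus a b ^^ n) (phi a b r 0) = phi a b r (frac (real n * r))"
proof (induction n)
  case (Suc n)
  have "frac (frac (real n * r) + r) = frac (real (Suc n) * r)"
    by (simp add: algebra_simps)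
  with Suc show ?case
    by (simp add: f_minus_phi[OF assms] frac_lt_1)
qed simp

lemma f_plus_funpow_reflect: "(f_plus a b ^^ n) (1 - y) = 1 - (f_minus a (1 - a - b) ^^ n) y"
  by (induction n) (auto simp: f_plus_reflect)

text \<open>With \<open>q\<close> the denominator of \<open>r\<close>, rotating 0 by
  \<open>r\<close> returns to 0 after \<open>q\<close> steps, so its image under \<open>phi\<close>
  is periodic; in the second case the reflected point is periodic for \<open>f_plus\<close>.\<close>

lemma ex_periodic_point:
  assumes nonneg: "0 \<le> phi a b r 0" "0 \<le> phi a (1 - a - b) (- r) 0" and "r \<in> \<rat>"
  obtains f c q where "f = f_minus a b \<or> f = f_plus a b" "c \<in> {0..1}" "1 \<le> q" "(f ^^ q) c = c"
proof -
  obtain p q :: int where r: "r = of_int p / of_int q" and q: "0 < q"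
    using \<open>r \<in> \<rat>\<close> by (meson Rats_cases')
  have qr: "real (nat q) * r = of_int p" "real (nat q) * (- r) = of_int (- p)"
    using q by (simp_all add: r)
  from phi_less_1_cases[OF nonneg] show ?thesis
  proof
    assume *: "\<forall>x<1. phi a b r x < 1"
    have "(f_minus a b ^^ nat q) (phi a b r 0) = phi a b r 0"
      using * f_minus_funpow_phi_0[OF nonneg(1), of "nat q"] by (simp only: qr frac_of_int)
    with * nonneg q show ?thesis
      by (intro that[of "f_minus a b" "phi a b r 0" "nat q"]) (auto intro: less_imp_le)
  next
    assume *: "\<forall>x<1. phi a (1 - a - b) (- r) x < 1"
    have "(f_minus a (1 - a - b) ^^ nat q) (phi a (1 - a - b) (- r) 0) = phi a (1 - a - b) (- r) 0"
      using * f_minus_funpow_phi_0[OF nonneg(2), of "nat q"] by (simp only: qr frac_of_int)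
    with * nonneg q show ?thesis
      by (intro that[of "f_plus a b" "1 - phi a (1 - a - b) (- r) 0" "nat q"])
         (auto intro: less_imp_le simp: f_plus_funpow_reflect)
  qed
qed

lemma unif_orbit:
  assumes f: "f = f_minus a b \<or> f = f_plus a b" and "1 \<le> q"
    and x: "\<And>n. x (n + q) = x n" "\<And>n. x (Suc n) = f (x n)" "\<And>n. x n \<in> {0..1}"
  shows "finite (range x)" "range x \<noteq> {}" "range x \<subseteq> {0..1}"
    "borel_prob_on_unit (unif (range x))"
    "invariant_under (f_minus a b) (unif (range x)) \<or> invariant_under (f_plus a b) (unif (range x))"
proof -
  note C = periodic_range[OF \<open>1 \<le> q\<close> x(1,2)]
  show fin: "finite (range x)" and ne: "range x \<noteq> {}" and sub: "range x \<subseteq> {0..1}"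
    using C x(3) by blast+
  show "borel_prob_on_unit (unif (range x))" using fin ne sub by (rule borel_prob_on_unit_unif)
  have "f \<in> measurable unit_borel unit_borel"
    using f f_minus_measurable f_plus_measurable by blast
  from invariant_under_unif[OF fin ne sub this C(2)]
  show "invariant_under (f_minus a b) (unif (range x)) \<or> invariant_under (f_plus a b) (unif (range x))"
    using f by blast
qed

lemma range_orbit_unique:
  assumes b: "0 \<le> b" "b < 1"
    and f: "f = f_minus a b \<or> f = f_plus a b" and q: "1 \<le> q"
    and x: "\<And>n. x (n + q) = x n" "\<And>n. x (Suc n) = f (x n)" "\<And>n. x n \<in> {0..1}"
    and g: "g = f_minus a b \<or> g = f_plus a b" and p: "1 \<le> p"
    and y: "\<And>n. y (n + p) = y n" "\<And>n. y (Suc n) = g (y n)" "\<And>n. y n \<in> {0..1}"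
  shows "range x = range y"
proof -
  note X = unif_orbit[OF f q, of x, OF x] and Y = unif_orbit[OF g p, of y, OF y]
  have eq: "unif (range x) = unif (range y)"
    using b X(4,5) Y(4,5) by (rule invariant_unique)
  show ?thesis
    using unif_subset[OF X(1-3) Y(1-3) eq] unif_subset[OF Y(1-3) X(1-3) eq[symmetric]] by blast
qed

lemma periodic_point_orbit:
  assumes f: "f = f_minus a b \<or> f = f_plus a b" and c: "c \<in> {0..1}" and m: "(f ^^ m) c = c"
  shows "(f ^^ (n + m)) c = (f ^^ n) c" "(f ^^ Suc n) c = f ((f ^^ n) c)" "(f ^^ n) c \<in> {0..1}"
proof -
  show "(f ^^ (n + m)) c = (f ^^ n) c" using m by (simp add: funpow_add)
  show "(f ^^ Suc n) c = f ((f ^^ n) c)" by simp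
  have "f y \<in> {0..1}" for y
    using f f_minus_Ico[of a b y] f_plus_Ioc[of a b y] by auto
  then show "(f ^^ n) c \<in> {0..1}" using c by (cases n) auto
qed

text \<open>An orbit using both branches visits the ambiguous point \<open>c\<close> and leaves it
  once along each. Cutting at returns to \<open>c\<close> gives loops of \<open>f_minus\<close> and
  \<open>f_plus\<close> through \<open>c\<close>, which \<open>range_orbit_unique\<close> forces to
  have the same points.\<close>

lemma periodic_orbit_single_valued:
  assumes b: "0 \<le> b" "b < 1" and x: "is_periodic_orbit a b x"
  shows "(\<forall>n. x (Suc n) = f_minus a b (x n)) \<or> (\<forall>n. x (Suc n) = f_plus a b (x n))"
proof (rule ccontr)
  assume "\<not> ?thesis"
  then obtain i j where ij: "x (Suc i) \<noteq> f_minus a b (x i)" "x (Suc j) \<noteq> f_plus a b (x j)" by blast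
  obtain q where q: "1 \<le> q" "\<And>n. x (n + q) = x n"
    using x by (auto simp: is_periodic_orbit_def)
  have x01: "x n \<in> {0..1}" and step: "x (Suc n) = f_minus a b (x n) \<or> x (Suc n) = f_plus a b (x n)" for n
    using x by (auto simp: is_periodic_orbit_def is_orbit_def f_pm_def)
  define c where "c = x i"
  have c: "f_minus a b c \<noteq> f_plus a b c" using ij(1) step[of i] by (auto simp: c_def)
  have unique: "y = c" if "y \<in> {0..1}" "f_minus a b y \<noteq> f_plus a b y" for y
  proof -
    \<comment> \<open>Both values are integers, and \<open>a < 1\<close> keeps them less than 1
      apart, so there is only one ambiguous point.\<close>
    have "(a * y + b) - (a * c + b) \<in> \<int>"
      using f_minus_neq_f_plus(1)[OF that(2)] f_minus_neq_f_plus(1)[OF c] by (rule Ints_diff)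
    moreover have "\<bar>(a * y + b) - (a * c + b)\<bar> < 1"
    proof -
      have "\<bar>y - c\<bar> \<le> 1" using that(1) x01[of i] by (auto simp: c_def)
      then have "a * \<bar>y - c\<bar> \<le> a" using a_pos by simp
      moreover have "\<bar>a * (y - c)\<bar> = a * \<bar>y - c\<bar>" using a_pos by (simp add: abs_mult)
      ultimately have "\<bar>a * (y - c)\<bar> < 1" using a_less_1 by linarith
      then show ?thesis by (simp add: right_diff_distrib)
    qed
    ultimately have "(a * y + b) - (a * c + b) = 0"
      using Ints_nonzero_abs_less1 by blast
    then show ?thesis using a_pos by simp
  qed
  have "x j = c" using ij(2) step[of j] x01[of j] by (intro unique) auto
  have off: "f_minus a b (x n) = f_plus a b (x n)" if "x n \<noteq> c" for n
    using unique[OF x01] that by blast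
  have "\<exists>m\<ge>1. (f_minus a b ^^ m) c = c"
  proof (rule ex_funpow_return[of x j c q])
    show "x (Suc j) = f_minus a b c" using ij(2) step[of j] \<open>x j = c\<close> by auto
    show "x (Suc n) = f_minus a b (x n)" if "x n \<noteq> c" for n
      using step[of n] off[OF that] by auto
  qed (use q \<open>x j = c\<close> in auto)
  then obtain m where m: "1 \<le> m" "(f_minus a b ^^ m) c = c" by blast
  have "\<exists>m\<ge>1. (f_plus a b ^^ m) c = c"
  proof (rule ex_funpow_return[of x i c q])
    show "x (Suc i) = f_plus a b c" using ij(1) step[of i] by (auto simp: c_def)
    show "x (Suc n) = f_plus a b (x n)" if "x n \<noteq> c" for n
      using step[of n] off[OF that] by auto
  qed (use q in \<open>auto simp: c_def\<close>)
  then obtain k where k: "1 \<le> k" "(f_plus a b ^^ k) c = c" by blast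
  have "c \<in> {0..1}" using x01 by (simp add: c_def)
  have minus: "f_minus a b = f_minus a b \<or> f_minus a b = f_plus a b"
    and plus: "f_plus a b = f_minus a b \<or> f_plus a b = f_plus a b" by auto
  note M = periodic_point_orbit[OF minus \<open>c \<in> {0..1}\<close> m(2)]
  note P = periodic_point_orbit[OF plus \<open>c \<in> {0..1}\<close> k(2)]
  have *: "range (\<lambda>n. (f_minus a b ^^ n) c) = range (\<lambda>n. (f_plus a b ^^ n) c)"
    using b minus m(1) M plus k(1) P by (rule range_orbit_unique)
  \<comment> \<open>The \<open>f_plus\<close> loop contains 1, the value of \<open>f_plus\<close> at
    \<open>c\<close>, whereas every point of the \<open>f_minus\<close> loop is a value of
    \<open>f_minus\<close> and hence below 1.\<close>
  have "(f_plus a b ^^ 1) c \<in> range (\<lambda>n. (f_plus a b ^^ n) c)" by (rule rangeI)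
  then have "1 \<in> range (\<lambda>n. (f_minus a b ^^ n) c)"
    using f_minus_neq_f_plus(3)[OF c] by (simp add: *)
  then obtain n where n: "1 = (f_minus a b ^^ n) c" by blast
  \<comment> \<open>Adding the period provides a predecessor even for \<open>n = 0\<close>.\<close>
  have "(f_minus a b ^^ (n + m)) c = f_minus a b ((f_minus a b ^^ (n + m - 1)) c)"
    using m(1) M(2)[of "n + m - 1"] by simp
  then have "1 = f_minus a b ((f_minus a b ^^ (n + m - 1)) c)"
    using n M(1)[of n] by simp
  then show False using f_minus_Ico[of a b "(f_minus a b ^^ (n + m - 1)) c"] by simp
qed

section \<open>Invariance of \<open>mu\<close> in the rational and the irrational case\<close>

lemma mu_rational:
  assumes b: "0 \<le> b" "b < 1" and r: "is_rotation_number a b r" "r \<in> \<rat>"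
    and nonneg: "0 \<le> phi a b r 0" "0 \<le> phi a (1 - a - b) (- r) 0"
  shows "borel_prob_on_unit (mu a b)"
    and "invariant_under (f_minus a b) (mu a b) \<or> invariant_under (f_plus a b) (mu a b)"
proof -
  obtain f c q where f: "f = f_minus a b \<or> f = f_plus a b" and c: "c \<in> {0..1}"
    and q: "1 \<le> q" "(f ^^ q) c = c"
    using nonneg r(2) by (rule ex_periodic_point)
  define x where "x n = (f ^^ n) c" for n
  note x = periodic_point_orbit[OF f c q(2), folded x_def]
  have "is_periodic_orbit a b x"
    unfolding is_periodic_orbit_def is_orbit_def f_pm_def
    using x q(1) f by auto
  \<comment> \<open>The definite description ranges over orbits of the multi-valued map, so a
    competing orbit is first reduced to a single branch.\<close>
  have "periodic_set a b = range x"
    unfolding periodic_set_def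
  proof (rule the_equality)
    show "\<exists>y. is_periodic_orbit a b y \<and> range x = range y"
      using \<open>is_periodic_orbit a b x\<close> by blast
    fix C assume "\<exists>y. is_periodic_orbit a b y \<and> C = range y"
    then obtain y where y: "is_periodic_orbit a b y" and C: "C = range y" by blast
    obtain p where p: "1 \<le> p" "\<And>n. y (n + p) = y n" and y01: "\<And>n. y n \<in> {0..1}"
      using y by (auto simp: is_periodic_orbit_def is_orbit_def)
    obtain g where g: "g = f_minus a b \<or> g = f_plus a b" "\<And>n. y (Suc n) = g (y n)"
      using periodic_orbit_single_valued[OF b y] by blast
    have "range y = range x"
      using b g(1) p(1,2) g(2) y01 f q(1) x by (rule range_orbit_unique)
    with C show "C = range x" by simp
  qed
  then have "mu a b = unif (range x)"
    using rotation_number_eqI[OF r(1)] r(2) by (simp add: mu_def unif_def)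
  with unif_orbit(4,5)[OF f q(1), of x, OF x]
  show "borel_prob_on_unit (mu a b)"
    and "invariant_under (f_minus a b) (mu a b) \<or> invariant_under (f_plus a b) (mu a b)" by simp_all
qed

lemma mu_irrational:
  assumes r: "is_rotation_number a b r" "r \<notin> \<rat>"
    and nonneg: "0 \<le> phi a b r 0" "0 \<le> phi a (1 - a - b) (- r) 0"
  shows "borel_prob_on_unit (mu a b)" and "invariant_under (f_minus a b) (mu a b)"
proof -
  have r01: "0 \<le> r" "r < 1" using r(1) by (auto simp: is_rotation_number_def)
  have mu: "mu a b = distr (restrict_space lborel {0..1}) unit_borel (phi a b r)"
    using rotation_number_eqI[OF r(1)] r(2) by (simp add: mu_def)
  have less: "phi a b r x < 1" if "x < 1" for x
    using nonneg r(2) that by (rule phi_less_1_irrational)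
  have "phi a b r 1 = 1"
    using nonneg phi_reflect_eq_0[OF r(2), of b] phi_add_1[of b r 0] by simp
  then have phi01: "phi a b r x \<in> {0..1}" if "x \<in> {0..1}" for x
    using that nonneg phi_mono[of 0 x b r] phi_mono[of x 1 b r] by auto
  have phi_borel: "phi a b r \<in> borel_measurable borel"
    by (intro borel_measurable_mono monoI phi_mono)
  have phi_meas: "phi a b r \<in> measurable (restrict_space lborel {0..1}) unit_borel"
    unfolding unit_borel_def using phi_borel phi01 by (intro measurable_restrict_space3) auto
  have "prob_space (restrict_space lborel {0..1::real})"
    by (rule prob_spaceI) (simp add: emeasure_restrict_space space_restrict_space)
  then show "borel_prob_on_unit (mu a b)"
    using phi_meas by (simp add: borel_prob_on_unit_def mu prob_space.prob_space_distr)
  \<comment> \<open>The endpoint 1 is a null set; it is dropped because \<open>f_minus_phi\<close>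
    covers only arguments below 1.\<close>
  have emeasure_mu: "emeasure (mu a b) A = emeasure lborel (phi a b r -` A \<inter> {0..<1})"
    if A: "A \<in> sets unit_borel" for A
  proof -
    have "A \<in> sets borel" using A by (simp add: sets_unit_borel_iff)
    then have vim: "phi a b r -` A \<in> sets borel"
      using measurable_sets[OF phi_borel] by simp
    have "emeasure (mu a b) A = emeasure (restrict_space lborel {0..1}) (phi a b r -` A \<inter> {0..1})"
      using emeasure_distr[OF phi_meas A] by (simp add: mu space_restrict_space)
    also have "\<dots> = emeasure lborel (phi a b r -` A \<inter> {0..1})"
      by (intro emeasure_restrict_space) auto
    finally show ?thesis by (simp add: emeasure_lborel_Int_01[OF vim])
  qed
  show "invariant_under (f_minus a b) (mu a b)"
    unfolding invariant_under_def
  proof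
    have sets_mu: "sets (mu a b) = sets unit_borel" by (simp add: mu)
    then show "f_minus a b \<in> measurable (mu a b) (mu a b)"
      using f_minus_measurable by (simp cong: measurable_cong_sets)
    show "\<forall>A\<in>sets (mu a b). emeasure (mu a b) (f_minus a b -` A \<inter> space (mu a b)) = emeasure (mu a b) A"
    proof
      fix A assume "A \<in> sets (mu a b)"
      then have A: "A \<in> sets unit_borel" by (simp add: sets_mu)
      then have "A \<in> sets borel" by (simp add: sets_unit_borel_iff)
      then have vim: "phi a b r -` A \<in> sets borel"
        using measurable_sets[OF phi_borel] by simp
      have fA: "f_minus a b -` A \<inter> {0..1} \<in> sets unit_borel"
        using measurable_sets[OF f_minus_measurable A] by (simp add: space_unit_borel)
      have "space (mu a b) = {0..1}" by (simp add: mu space_unit_borel)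
      then have "emeasure (mu a b) (f_minus a b -` A \<inter> space (mu a b))
          = emeasure lborel (phi a b r -` (f_minus a b -` A \<inter> {0..1}) \<inter> {0..<1})"
        using emeasure_mu[OF fA] by simp
      also have "phi a b r -` (f_minus a b -` A \<inter> {0..1}) \<inter> {0..<1}
          = {x. frac (x + r) \<in> phi a b r -` A} \<inter> {0..<1}"
      proof (rule set_eqI)
        fix x
        show "x \<in> phi a b r -` (f_minus a b -` A \<inter> {0..1}) \<inter> {0..<1} \<longleftrightarrow>
            x \<in> {x. frac (x + r) \<in> phi a b r -` A} \<inter> {0..<1}"
          using f_minus_phi[OF nonneg(1) less, of x] phi01[of x]
          by (cases "x \<in> {0..<1}") auto
      qed
      also have "emeasure lborel \<dots> = emeasure lborel (phi a b r -` A \<inter> {0..<1})"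
        using vim r01 by (rule emeasure_lborel_rotation)
      also have "\<dots> = emeasure (mu a b) A" using emeasure_mu[OF A] by simp
      finally show "emeasure (mu a b) (f_minus a b -` A \<inter> space (mu a b)) = emeasure (mu a b) A" .
    qed
  qed
qed

end

theorem theorem10p3:
  fixes a b :: real
  assumes "0 < a" "a < 1" "0 \<le> b" "b < 1"
  shows "borel_prob_on_unit (mu a b) \<and>
    (\<forall>\<nu>. borel_prob_on_unit \<nu> \<longrightarrow>
       (invariant_under (f_minus a b) \<nu> \<or> invariant_under (f_plus a b) \<nu> \<longleftrightarrow> \<nu> = mu a b))"
proof -
  interpret contraction a using assms by unfold_locales
  obtain r where r: "0 \<le> r" "r < 1"
    and nonneg: "0 \<le> phi a b r 0" "0 \<le> phi a (1 - a - b) (- r) 0"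
    using assms(3,4) by (rule ex_phi_0_nonneg)
  from r nonneg have rot: "is_rotation_number a b r" by (rule is_rotation_numberI)
  have mu: "borel_prob_on_unit (mu a b)"
      "invariant_under (f_minus a b) (mu a b) \<or> invariant_under (f_plus a b) (mu a b)"
    using mu_rational[OF assms(3,4) rot _ nonneg] mu_irrational[OF rot _ nonneg]
    by (cases "r \<in> \<rat>"; blast)+
  then show ?thesis
    using invariant_unique[OF assms(3,4) _ _ mu] by blast
qed

end
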